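(* Let $R$ be one of the following complex Lie algebras (each with basis consisting of the basis $e_1,\dots,e_m$ of the indicated nilpotent Lie algebra plus one element $x$, brackets among the $e_i$ as in that nilpotent algebra, and brackets with $x$ as listed, all others zero): $R(g^3_{(n,1)},1)$ ($n\ge7$): $[e_1,x]=-[x,e_1]=e_1$, $[e_i,x]=-[x,e_i]=(i+1)e_i$ ($2\le i\le n-1$), $[e_n,x]=-[x,e_n]=2e_n$; $R(g^1_7,1)$: $[e_i,x]=-[x,e_i]=ie_i$ ($1\le i\le 7$); $R(g^2_9,1)$: $[e_i,x]=-[x,e_i]=ie_i$ ($1\le i\le 9$); $R(g^3_{11},1)$: $[e_i,x]=-[x,e_i]=ie_i$ ($1\le i\le 11$). Then $\dim H^2(R,R)=1$.
   Context: $H^2(R,R)$ is the second Chevalley–Eilenberg cohomology of the Lie algebra $R$ with adjoint coefficients. The nilpotent Lie algebras (only listed brackets and their antisymmetric counterparts nonzero): $g^3_{(n,1)}$ ($n\ge7$): $[e_1,e_i]=e_{i+1}$ ($2\le i\le n-2$); $[e_i,e_n]=e_{i+2}$ ($2\le i\le n-3$); $[e_2,e_i]=e_{i+3}$ ($3\le i\le n-4$). $g^1_7$: $[e_1,e_i]=e_{i+1}$ ($2\le i\le 5$); $[e_2,e_i]=e_{i+2}$ ($3\le i\le 4$); $[e_i,e_{7-i}]=(-1)^ie_7$ ($2\le i\le 3$). $g^2_9$: $[e_1,e_i]=e_{i+1}$ ($2\le i\le 7$); $[e_2,e_i]=e_{i+2}$ ($3\le i\le 4$); $[e_2,e_5]=3e_7$;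 $[e_2,e_6]=5e_8$; $[e_3,e_i]=-2e_{i+3}$ ($4\le i\le5$); $[e_i,e_{9-i}]=(-1)^ie_9$ ($2\le i\le 4$). $g^3_{11}$: $[e_1,e_i]=e_{i+1}$ ($2\le i\le 9$); $[e_2,e_i]=e_{i+2}$ ($3\le i\le 4$); $[e_2,e_i]=-e_{i+2}$ ($6\le i\le 7$); $[e_3,e_7]=-e_{10}$; $[e_3,e_i]=e_{i+3}$ ($4\le i\le 5$); $[e_4,e_i]=e_{i+4}$ ($5\le i\le 6$); $[e_i,e_{11-i}]=(-1)^ie_{11}$ ($2\le i\le 5$). *)

theory Defs
  imports Main "HOL-Analysis.Analysis" "HOL-Library.Function_Algebras"
begin

text \<open>A complex Lie algebra of dimension N with basis e_1..e_N is given by structure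
constants: br i j k is the coefficient of e_k in [e_i,e_j].  We build br from a table
pos i j k of the brackets [e_i,e_j] with i < j (antisymmetric counterparts added).\<close>

definition lie_br :: "nat \<Rightarrow> (nat \<Rightarrow> nat \<Rightarrow> nat \<Rightarrow> complex) \<Rightarrow> nat \<Rightarrow> nat \<Rightarrow> nat \<Rightarrow> complex" where
  "lie_br N pos i j k =
     (if i \<in> {1..N} \<and> j \<in> {1..N} \<and> k \<in> {1..N} then
        (if i < j then pos i j k else if j < i then - pos j i k else 0)
      else 0)"

text \<open>Adjoint-coefficient cochains in coordinates w.r.t. the basis.
1-cochains (linear maps R \<rightarrow> R): phi i k = coefficient of e_k in phi(e_i).
2-cochains (alternating bilinear maps): w i j k = coefficient of e_k in w(e_i,e_j).\<close>

definition C1 :: "nat \<Rightarrow> (nat \<Rightarrow> nat \<Rightarrow> complex) set" where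
  "C1 N = {phi. \<forall>i k. (i \<notin> {1..N} \<or> k \<notin> {1..N}) \<longrightarrow> phi i k = 0}"

definition C2 :: "nat \<Rightarrow> (nat \<Rightarrow> nat \<Rightarrow> nat \<Rightarrow> complex) set" where
  "C2 N = {w. (\<forall>i j k. (i \<notin> {1..N} \<or> j \<notin> {1..N} \<or> k \<notin> {1..N}) \<longrightarrow> w i j k = 0)
              \<and> (\<forall>i j k. w i j k = - w j i k)}"

text \<open>(d phi)(x,y) = [x,phi y] - [y,phi x] - phi([x,y])\<close>
definition d1 :: "nat \<Rightarrow> (nat \<Rightarrow> nat \<Rightarrow> nat \<Rightarrow> complex) \<Rightarrow> (nat \<Rightarrow> nat \<Rightarrow> complex) \<Rightarrow> nat \<Rightarrow> nat \<Rightarrow> nat \<Rightarrow> complex" where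
  "d1 N br phi i j k = (\<Sum>l\<in>{1..N}. phi j l * br i l k - phi i l * br j l k - br i j l * phi l k)"

text \<open>(d w)(x,y,z) = [x,w(y,z)] - [y,w(x,z)] + [z,w(x,y)] - w([x,y],z) + w([x,z],y) - w([y,z],x)\<close>
definition d2 :: "nat \<Rightarrow> (nat \<Rightarrow> nat \<Rightarrow> nat \<Rightarrow> complex) \<Rightarrow> (nat \<Rightarrow> nat \<Rightarrow> nat \<Rightarrow> complex) \<Rightarrow> nat \<Rightarrow> nat \<Rightarrow> nat \<Rightarrow> nat \<Rightarrow> complex" where
  "d2 N br w i j k m = (\<Sum>l\<in>{1..N}.
      w j k l * br i l m - w i k l * br j l m + w i j l * br k l m
    - br i j l * w l k m + br i k l * w l j m - br j k l * w l i m)"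

definition Z2 :: "nat \<Rightarrow> (nat \<Rightarrow> nat \<Rightarrow> nat \<Rightarrow> complex) \<Rightarrow> (nat \<Rightarrow> nat \<Rightarrow> nat \<Rightarrow> complex) set" where
  "Z2 N br = {w \<in> C2 N. \<forall>i j k m. d2 N br w i j k m = 0}"

definition B2 :: "nat \<Rightarrow> (nat \<Rightarrow> nat \<Rightarrow> nat \<Rightarrow> complex) \<Rightarrow> (nat \<Rightarrow> nat \<Rightarrow> nat \<Rightarrow> complex) set" where
  "B2 N br = d1 N br ` C1 N"

definition cdim3 :: "(nat \<Rightarrow> nat \<Rightarrow> nat \<Rightarrow> complex) set \<Rightarrow> nat" where
  "cdim3 = vector_space.dim (\<lambda>(c::complex) w. \<lambda>i j k. c * w i j k)"

text \<open>dim H^2(R,R) = dim Z^2 - dim B^2 (B^2 \<subseteq> Z^2, all finite-dimensional)\<close>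
definition dimH2 :: "nat \<Rightarrow> (nat \<Rightarrow> nat \<Rightarrow> nat \<Rightarrow> complex) \<Rightarrow> nat" where
  "dimH2 N br = cdim3 (Z2 N br) - cdim3 (B2 N br)"

text \<open>R(g^3_(n,1),1): basis e_1..e_n, x = e_(n+1).\<close>
definition pos_R_g3n1 :: "nat \<Rightarrow> nat \<Rightarrow> nat \<Rightarrow> nat \<Rightarrow> complex" where
  "pos_R_g3n1 n i j k =
     (if i = 1 \<and> 2 \<le> j \<and> j \<le> n - 2 \<and> k = j + 1 then 1 else 0)
   + (if j = n \<and> 2 \<le> i \<and> i \<le> n - 3 \<and> k = i + 2 then 1 else 0)
   + (if i = 2 \<and> 3 \<le> j \<and> j \<le> n - 4 \<and> k = j + 3 then 1 else 0)
   + (if j = n + 1 \<and> i = 1 \<and> k = 1 then 1 else 0)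
   + (if j = n + 1 \<and> 2 \<le> i \<and> i \<le> n - 1 \<and> k = i then of_nat (i + 1) else 0)
   + (if j = n + 1 \<and> i = n \<and> k = n then 2 else 0)"

text \<open>R(g^1_7,1): basis e_1..e_7, x = e_8.\<close>
definition pos_R_g17 :: "nat \<Rightarrow> nat \<Rightarrow> nat \<Rightarrow> complex" where
  "pos_R_g17 i j k =
     (if i = 1 \<and> 2 \<le> j \<and> j \<le> 5 \<and> k = j + 1 then 1 else 0)
   + (if i = 2 \<and> 3 \<le> j \<and> j \<le> 4 \<and> k = j + 2 then 1 else 0)
   + (if 2 \<le> i \<and> i \<le> 3 \<and> j = 7 - i \<and> k = 7 then (-1) ^ i else 0)
   + (if j = 8 \<and> 1 \<le> i \<and> i \<le> 7 \<and> k = i then of_nat i else 0)"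

text \<open>R(g^2_9,1): basis e_1..e_9, x = e_10.\<close>
definition pos_R_g29 :: "nat \<Rightarrow> nat \<Rightarrow> nat \<Rightarrow> complex" where
  "pos_R_g29 i j k =
     (if i = 1 \<and> 2 \<le> j \<and> j \<le> 7 \<and> k = j + 1 then 1 else 0)
   + (if i = 2 \<and> 3 \<le> j \<and> j \<le> 4 \<and> k = j + 2 then 1 else 0)
   + (if i = 2 \<and> j = 5 \<and> k = 7 then 3 else 0)
   + (if i = 2 \<and> j = 6 \<and> k = 8 then 5 else 0)
   + (if i = 3 \<and> 4 \<le> j \<and> j \<le> 5 \<and> k = j + 3 then -2 else 0)
   + (if 2 \<le> i \<and> i \<le> 4 \<and> j = 9 - i \<and> k = 9 then (-1) ^ i else 0)
   + (if j = 10 \<and> 1 \<le> i \<and> i \<le> 9 \<and> k = i then of_nat i else 0)"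

text \<open>R(g^3_11,1): basis e_1..e_11, x = e_12.\<close>
definition pos_R_g311 :: "nat \<Rightarrow> nat \<Rightarrow> nat \<Rightarrow> complex" where
  "pos_R_g311 i j k =
     (if i = 1 \<and> 2 \<le> j \<and> j \<le> 9 \<and> k = j + 1 then 1 else 0)
   + (if i = 2 \<and> 3 \<le> j \<and> j \<le> 4 \<and> k = j + 2 then 1 else 0)
   + (if i = 2 \<and> 6 \<le> j \<and> j \<le> 7 \<and> k = j + 2 then -1 else 0)
   + (if i = 3 \<and> j = 7 \<and> k = 10 then -1 else 0)
   + (if i = 3 \<and> 4 \<le> j \<and> j \<le> 5 \<and> k = j + 3 then 1 else 0)
   + (if i = 4 \<and> 5 \<le> j \<and> j \<le> 6 \<and> k = j + 4 then 1 else 0)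
   + (if 2 \<le> i \<and> i \<le> 5 \<and> j = 11 - i \<and> k = 11 then (-1) ^ i else 0)
   + (if j = 12 \<and> 1 \<le> i \<and> i \<le> 11 \<and> k = i then of_nat i else 0)"

end

theory Submission
  imports Defs
begin

text \<open>The element \<open>x\<close> acts diagonally, and its eigenvalues grade \<open>R\<close> with one-dimensional pieces
in the degrees \<open>0, \<dots>, n\<close> (\<open>x\<close> itself has degree 0). Contraction with \<open>x\<close> shows that every cocycle
is cohomologous to one of weight zero, that is, to a family of numbers \<open>a p q\<close> with
\<open>w(f\<^sub>p, f\<^sub>q) = a p q f\<^sub>p\<^sub>+\<^sub>q\<close>. The coefficients \<open>a 0 q\<close> form a diagonal derivation, which is a multiple of
the grading and can be removed by rescaling \<open>x\<close>; the remaining coboundaries are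
\<open>(c p + c q - c (p + q)) A p q\<close>, where \<open>A\<close> is the bracket table. Using them to kill \<open>a\<close> at suitable
pairs \<open>G\<close> with \<open>A p q \<noteq> 0\<close>, the linear cocycle conditions leave exactly one free parameter, and the
resulting cocycle is nonzero at a pair where \<open>A\<close> vanishes, so it is not a coboundary.\<close>

section \<open>Dimension of a space obtained by adding one vector to a subspace\<close>

interpretation V3: vector_space "\<lambda>(c::complex) (w::nat \<Rightarrow> nat \<Rightarrow> nat \<Rightarrow> complex). \<lambda>i j k. c * w i j k"
  by unfold_locales (auto simp: fun_eq_iff algebra_simps)

lemma sum_fun3_apply:
  "(\<Sum>t\<in>T. f t) i j k = (\<Sum>t\<in>T. f t i j (k::'d) :: 'e::comm_monoid_add)"
  by (induction T rule: infinite_finite_induct) auto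

text \<open>The dimension is the cardinality of a basis, which is 0 for an infinite set, so
  finiteness has to be secured. The elementary cochains, one for each triple of basis indices,
  span.\<close>

lemma finite_spanning_family:
  obtains E where "finite E"
    "{w :: nat \<Rightarrow> nat \<Rightarrow> nat \<Rightarrow> complex.
        \<forall>i j k. i \<notin> {1..N} \<or> j \<notin> {1..N} \<or> k \<notin> {1..N} \<longrightarrow> w i j k = 0} \<subseteq> V3.span E"
proof
  define e :: "nat \<times> nat \<times> nat \<Rightarrow> nat \<Rightarrow> nat \<Rightarrow> nat \<Rightarrow> complex"
    where "e t i j k = (if t = (i, j, k) then 1 else 0)" for t i j k
  let ?T = "{1..N} \<times> {1..N} \<times> {1..N}"
  show "finite (e ` ?T)" by simp
  show "{w. \<forall>i j k. i \<notin> {1..N} \<or> j \<notin> {1..N} \<or> k \<notin> {1..N} \<longrightarrow> w i j k = 0} \<subseteq> V3.span (e ` ?T)"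
  proof safe
    fix w :: "nat \<Rightarrow> nat \<Rightarrow> nat \<Rightarrow> complex"
    assume w: "\<forall>i j k. i \<notin> {1..N} \<or> j \<notin> {1..N} \<or> k \<notin> {1..N} \<longrightarrow> w i j k = 0"
    have "w = (\<Sum>t\<in>?T. (\<lambda>i j k. w (fst t) (fst (snd t)) (snd (snd t)) * e t i j k))"
    proof (intro ext)
      fix i j k
      have "(\<Sum>t\<in>?T. w (fst t) (fst (snd t)) (snd (snd t)) * e t i j k) =
            (\<Sum>t\<in>?T. if t = (i, j, k) then w i j k else 0)"
        by (intro sum.cong) (auto simp: e_def)
      also have "\<dots> = w i j k"
        using w by (subst sum.delta) auto
      finally show "w i j k = (\<Sum>t\<in>?T. (\<lambda>i j k. w (fst t) (fst (snd t)) (snd (snd t)) * e t i j k)) i j k"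
        by (simp only: sum_fun3_apply)
    qed
    also have "\<dots> \<in> V3.span (e ` ?T)"
      by (intro V3.span_sum V3.span_scale V3.span_base) auto
    finally show "w \<in> V3.span (e ` ?T)" .
  qed
qed

text \<open>A basis \<open>S\<close> of \<open>B\<close> becomes a basis of \<open>Z\<close> once
  \<open>w\<close> is adjoined. The finite set \<open>E\<close> forces \<open>S\<close> to be
  finite, so the cardinality grows by exactly one and the subtraction of natural numbers is
  faithful.\<close>

lemma cdim3_insert:
  assumes B: "V3.subspace B" and fin: "finite E" "B \<subseteq> V3.span E"
    and BZ: "B \<subseteq> Z" and w: "w \<in> Z" "w \<notin> B"
    and Z: "\<And>z. z \<in> Z \<Longrightarrow> \<exists>b\<in>B. \<exists>c. z = b + (\<lambda>i j k. c * w i j k)"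
  shows "cdim3 Z - cdim3 B = 1"
proof -
  obtain S where S: "S \<subseteq> B" "V3.independent S" "B \<subseteq> V3.span S" "card S = V3.dim B"
    using V3.basis_exists by blast
  have finS: "finite S"
    using V3.independent_span_bound[OF fin(1) S(2)] S(1) fin(2) by blast
  have spS: "V3.span S = B"
    using S(1,3) B V3.span_minimal by blast
  have ind: "V3.independent (insert w S)"
    using S(2) w(2) spS V3.independent_insert by simp
  have "Z \<subseteq> V3.span (insert w S)"
  proof
    fix z assume "z \<in> Z"
    then obtain b c where b: "b \<in> B" "z = b + (\<lambda>i j k. c * w i j k)" using Z by blast
    have "b \<in> V3.span (insert w S)"
      using b(1) spS V3.span_mono[of S "insert w S"] by blast
    then show "z \<in> V3.span (insert w S)"
      unfolding b(2) by (rule V3.span_add) (intro V3.span_scale V3.span_base insertI1)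
  qed
  moreover have "insert w S \<subseteq> Z" using S(1) BZ w(1) by blast
  ultimately have "V3.span (insert w S) = V3.span Z"
    by (metis V3.span_mono V3.span_span subset_antisym)
  then have "V3.dim Z = card (insert w S)"
    using V3.dim_eq_card ind by metis
  moreover have "w \<notin> S" using S(1) w(2) by blast
  ultimately show ?thesis
    using finS S(4) by (simp add: cdim3_def)
qed

section \<open>Coboundaries are cocycles\<close>

lemma d1_eq:
  "d1 N br \<phi> i j k = (\<Sum>p\<in>{1..N}. \<phi> j p * br i p k) - (\<Sum>p\<in>{1..N}. \<phi> i p * br j p k)
     - (\<Sum>p\<in>{1..N}. br i j p * \<phi> p k)"
  by (simp add: d1_def sum_subtractf)

lemma d2_eq:
  "d2 N br w i j k m = (\<Sum>l\<in>{1..N}. w j k l * br i l m) - (\<Sum>l\<in>{1..N}. w i k l * br j l m)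
     + (\<Sum>l\<in>{1..N}. w i j l * br k l m) - (\<Sum>l\<in>{1..N}. br i j l * w l k m)
     + (\<Sum>l\<in>{1..N}. br i k l * w l j m) - (\<Sum>l\<in>{1..N}. br j k l * w l i m)"
  by (simp add: d2_def sum_subtractf sum.distrib)

text \<open>After expanding all brackets, the terms with \<open>\<phi>\<close> on a single argument
  cancel by the Jacobi identity, those with \<open>\<phi>\<close> on an inner bracket cancel in
  pairs, and those with \<open>\<phi>\<close> on a double bracket cancel by the Jacobi identity
  again.\<close>

lemma d2_d1:
  assumes anti: "\<And>i j k. br i j k = - br j i k"
    and jac: "\<And>i j k m. (\<Sum>l\<in>{1..N}. br i j l * br l k m) + (\<Sum>l\<in>{1..N}. br j k l * br l i m)
                + (\<Sum>l\<in>{1..N}. br k i l * br l j m) = 0"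
  shows "d2 N br (d1 N br \<phi>) i j k m = 0"
proof -
  define S where "S = {1..N}"
  \<comment> \<open>As components at \<open>m\<close>: \<open>X a b c\<close> is [e_c,
    [e_b, phi e_a]], \<open>Y a b c\<close> is [e_c, phi [e_a, e_b]], \<open>U a b c\<close> is
    [[e_a, e_b], phi e_c] and \<open>W a b c\<close> is phi [[e_a, e_b], e_c].\<close>
  define X where "X a b c = (\<Sum>l\<in>S. \<Sum>p\<in>S. \<phi> a p * br b p l * br c l m)" for a b c
  define Y where "Y a b c = (\<Sum>l\<in>S. \<Sum>p\<in>S. br a b p * \<phi> p l * br c l m)" for a b c
  define U where "U a b c = (\<Sum>l\<in>S. \<Sum>p\<in>S. \<phi> c p * br a b l * br l p m)" for a b c
  define W where "W a b c = (\<Sum>l\<in>S. \<Sum>p\<in>S. br a b l * br l c p * \<phi> p m)" for a b c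
  have outer: "(\<Sum>l\<in>S. d1 N br \<phi> b c l * br a l m) = X c b a - X b c a - Y b c a" for a b c
    unfolding d1_eq X_def Y_def S_def[symmetric]
    by (simp add: sum_subtractf left_diff_distrib sum_distrib_right)
  have inner: "(\<Sum>l\<in>S. br a b l * d1 N br \<phi> l c m) = U a b c - Y a b c - W a b c" for a b c
  proof -
    have "Y a b c = (\<Sum>l\<in>S. \<Sum>p\<in>S. br a b l * \<phi> l p * br c p m)"
      unfolding Y_def by (rule sum.swap)
    then show ?thesis
      unfolding d1_eq U_def W_def S_def[symmetric]
      by (simp add: sum_subtractf right_diff_distrib sum_distrib_left mult.assoc mult.left_commute)
  qed
  have jacU: "X c b a - X c a b - U a b c = 0" for a b c
  proof -
    have "X c b a - X c a b - U a b c =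
        (\<Sum>p\<in>S. \<phi> c p * ((\<Sum>l\<in>S. br b p l * br a l m) - (\<Sum>l\<in>S. br a p l * br b l m)
           - (\<Sum>l\<in>S. br a b l * br l p m)))"
      unfolding X_def U_def right_diff_distrib sum_subtractf sum_distrib_left
      by (subst (1 2 3) sum.swap) (simp add: mult.assoc)
    also have "\<dots> = 0"
    proof (rule sum.neutral, intro ballI)
      fix p
      have "(\<Sum>l\<in>S. br b p l * br a l m) = - (\<Sum>l\<in>S. br b p l * br l a m)"
        by (subst anti[of a]) (simp add: sum_negf)
      moreover have "(\<Sum>l\<in>S. br a p l * br b l m) = (\<Sum>l\<in>S. br p a l * br l b m)"
        by (subst anti[of a], subst anti[of b]) simp
      ultimately show "\<phi> c p * ((\<Sum>l\<in>S. br b p l * br a l m) - (\<Sum>l\<in>S. br a p l * br b l m)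
           - (\<Sum>l\<in>S. br a b l * br l p m)) = 0"
        using jac[of a b p m] unfolding S_def[symmetric] by algebra
    qed
    finally show ?thesis .
  qed
  have jacW: "W i j k - W i k j + W j k i = 0"
  proof -
    have "W i j k - W i k j + W j k i =
        (\<Sum>p\<in>S. ((\<Sum>l\<in>S. br i j l * br l k p) - (\<Sum>l\<in>S. br i k l * br l j p)
           + (\<Sum>l\<in>S. br j k l * br l i p)) * \<phi> p m)"
      unfolding W_def left_diff_distrib distrib_right sum_subtractf sum.distrib sum_distrib_right
      by (subst (1 2 3) sum.swap) simp
    also have "\<dots> = 0"
    proof (rule sum.neutral, intro ballI)
      fix p
      have "(\<Sum>l\<in>S. br i k l * br l j p) = - (\<Sum>l\<in>S. br k i l * br l j p)"
        by (subst anti[of i]) (simp add: sum_negf)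
      then show "((\<Sum>l\<in>S. br i j l * br l k p) - (\<Sum>l\<in>S. br i k l * br l j p)
           + (\<Sum>l\<in>S. br j k l * br l i p)) * \<phi> p m = 0"
        using jac[of i j k p] unfolding S_def[symmetric] by algebra
    qed
    finally show ?thesis .
  qed
  show ?thesis
    using jacU[of k j i] jacU[of j k i] jacU[of i k j] jacW
    unfolding d2_eq S_def[symmetric] outer inner by (simp add: algebra_simps)
qed

section \<open>Cochains of weight zero\<close>

text \<open>Weight-zero cochains are encoded by functions of the degrees: the Jacobi identity and
the cocycle condition both become the vanishing of this alternating form.\<close>

definition cyc :: "(nat \<Rightarrow> nat \<Rightarrow> complex) \<Rightarrow> (nat \<Rightarrow> nat \<Rightarrow> complex) \<Rightarrow> nat \<Rightarrow> nat \<Rightarrow> nat \<Rightarrow> complex" where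
  "cyc A a p q r = a p q * A (p + q) r + a q r * A (q + r) p + a r p * A (r + p) q
     + A p q * a (p + q) r + A q r * a (q + r) p + A r p * a (r + p) q"

definition skew :: "(nat \<Rightarrow> nat \<Rightarrow> complex) \<Rightarrow> nat \<Rightarrow> nat \<Rightarrow> complex" where
  "skew P p q = (if p < q then P p q else if q < p then - P q p else 0)"

lemma skew_anti: "skew P p q = - skew P q p"
  by (simp add: skew_def)

lemma cyc_rotate: "cyc A a p q r = cyc A a q r p"
  by (simp add: cyc_def)

lemma cyc_swap:
  assumes "\<And>p q. A p q = - A q p" "\<And>p q. a p q = - a q p"
  shows "cyc A a q p r = - cyc A a p q r"
  using assms(1)[of p q] assms(1)[of q r] assms(1)[of r p]
        assms(2)[of p q] assms(2)[of q r] assms(2)[of r p]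
  by (simp add: cyc_def add.commute)

text \<open>Rotations and one transposition generate all permutations, so the form is alternating
  and vanishes on repeated arguments. The largest argument is rotated to the end, then the other two
  are swapped if necessary.\<close>

lemma cyc_eq_0_if_sorted:
  assumes A: "\<And>p q. A p q = - A q p" and a: "\<And>p q. a p q = - a q p"
    and 0: "\<And>p q r. 0 < p \<Longrightarrow> p < q \<Longrightarrow> q < r \<Longrightarrow> p + q + r \<le> n \<Longrightarrow> cyc A a p q r = 0"
    and pos: "0 < p" "0 < q" "0 < r" "p + q + r \<le> n"
  shows "cyc A a p q r = 0"
proof -
  have sw: "cyc A a y x z = - cyc A a x y z" for x y z by (rule cyc_swap[OF A a])
  have diag: "cyc A a x x z = 0" for x z using sw[of x x z] by simp
  have sort: "cyc A a x y z = 0" if "0 < x" "0 < y" "x \<le> z" "y \<le> z" "x + y + z \<le> n" for x y z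
  proof -
    have "x = y \<or> y = z \<or> x = z \<or> x < y \<and> y < z \<or> y < x \<and> x < z"
      using that by linarith
    then consider "x = y" | "y = z" | "x = z" | "x < y" "y < z" | "y < x" "x < z"
      by blast
    then show ?thesis
    proof cases
      case 1 then show ?thesis by (simp add: diag)
    next
      case 2 then show ?thesis using diag[of z x] cyc_rotate[of A a x z z] by simp
    next
      case 3 then show ?thesis using diag[of z y] cyc_rotate[of A a z y z] cyc_rotate[of A a y z z] by simp
    next
      case 4 then show ?thesis using 0 that by simp
    next
      case 5 then show ?thesis using 0[of y x z] sw[of x y z] that by simp
    qed
  qed
  consider "p \<le> r \<and> q \<le> r" | "q \<le> p \<and> r \<le> p" | "r \<le> q \<and> p \<le> q" by linarith
  then show ?thesis
  proof cases
    case 1 then show ?thesis using sort[of p q r] pos by simp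
  next
    case 2 then show ?thesis using sort[of q r p] pos cyc_rotate[of A a p q r] by simp
  next
    case 3
    then have "cyc A a r p q = 0" using sort[of r p q] pos by simp
    then show ?thesis by (simp only: cyc_rotate[of A a p q r] cyc_rotate[of A a q r p])
  qed
qed

text \<open>For \<open>a = A\<close> the two halves of the form coincide; the Jacobi identity is
  recovered because 2 is invertible.\<close>

lemma cyc_self:
  "cyc A A p q r = 2 * (A p q * A (p + q) r + A q r * A (q + r) p + A r p * A (r + p) q)"
  unfolding cyc_def mult_2 by (simp only: add_ac)

lemma cyc_linear:
  "cyc A (\<lambda>p q. a p q - s * b p q) p q r = cyc A a p q r - s * cyc A b p q r"
  by (simp add: cyc_def algebra_simps)

text \<open>The coboundary of the diagonal map that multiplies the basis vector of degree
  \<open>p\<close> by \<open>c p\<close>.\<close>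

definition cob :: "(nat \<Rightarrow> nat \<Rightarrow> complex) \<Rightarrow> (nat \<Rightarrow> complex) \<Rightarrow> nat \<Rightarrow> nat \<Rightarrow> complex" where
  "cob A c p q = (c p + c q - c (p + q)) * A p q"

text \<open>Each product \<open>A p q * A (p + q) r\<close> occurs once in either half of the form,
  with factors \<open>c p + c q - c (p + q)\<close> and
  \<open>c (p + q) + c r - c (p + q + r)\<close>. The intermediate term telescopes and leaves a
  factor symmetric in the three degrees.\<close>

lemma cyc_cob: "2 * cyc A (cob A c) p q r = (c p + c q + c r - c (p + q + r)) * cyc A A p q r"
proof -
  have "q + r + p = p + q + r" "r + p + q = p + q + r" by simp_all
  then show ?thesis by (simp add: cyc_def cob_def algebra_simps)
qed

text \<open>Cochain of weight zero with coefficients \<open>a\<close>, where \<open>wt\<close> sends a basis index to its degree.\<close>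

definition gr :: "nat \<Rightarrow> (nat \<Rightarrow> nat) \<Rightarrow> (nat \<Rightarrow> nat \<Rightarrow> complex) \<Rightarrow> nat \<Rightarrow> nat \<Rightarrow> nat \<Rightarrow> complex" where
  "gr N wt a i j k =
     (if i \<in> {1..N} \<and> j \<in> {1..N} \<and> k \<in> {1..N} \<and> wt k = wt i + wt j then a (wt i) (wt j) else 0)"

lemma gr_outside: "i \<notin> {1..N} \<or> j \<notin> {1..N} \<or> k \<notin> {1..N} \<Longrightarrow> gr N wt a i j k = 0"
  by (simp only: gr_def if_False simp_thms split: if_split) blast

lemma gr_anti:
  assumes "\<And>p q. a p q = - a q p"
  shows "gr N wt a i j k = - gr N wt a j i k"
  using assms[of "wt i" "wt j"] by (auto simp: gr_def add.commute)

section \<open>Lie algebras graded by the eigenvalues of x\<close>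

locale graded =
  fixes N n :: nat and wt :: "nat \<Rightarrow> nat" and P :: "nat \<Rightarrow> nat \<Rightarrow> complex"
  assumes wt: "bij_betw wt {1..N} {..n}"
    and P0: "P 0 q = - of_nat q"
    and jac: "\<And>p q r. 0 < p \<Longrightarrow> p < q \<Longrightarrow> q < r \<Longrightarrow> p + q + r \<le> n \<Longrightarrow> cyc (skew P) (skew P) p q r = 0"
begin

abbreviation "A \<equiv> skew P"
abbreviation "br \<equiv> gr N wt A"

text \<open>Degree 0 is spanned by x; the signs come from the convention that [f, x] = q f for
  \<open>f\<close> of degree \<open>q\<close>.\<close>

lemma A0: "A 0 q = - of_nat q" "A q 0 = of_nat q"
  by (auto simp: skew_def P0)

definition base :: "nat \<Rightarrow> nat" where "base = inv_into {1..N} wt"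

lemma base: "p \<le> n \<Longrightarrow> base p \<in> {1..N}" "p \<le> n \<Longrightarrow> wt (base p) = p"
  using wt unfolding base_def bij_betw_def by (auto intro: inv_into_into f_inv_into_f simp del: atLeastAtMost_iff)

lemma wt_le: "i \<in> {1..N} \<Longrightarrow> wt i \<le> n"
  using wt unfolding bij_betw_def by auto

lemma wt_inj: "i \<in> {1..N} \<Longrightarrow> j \<in> {1..N} \<Longrightarrow> wt i = wt j \<longleftrightarrow> i = j"
  using wt unfolding bij_betw_def inj_on_def by blast

text \<open>Each degree up to \<open>n\<close> has exactly one basis index, so a sum over
  intermediate basis vectors of prescribed weight collapses to one term.\<close>

lemma sum_weight:
  "(\<Sum>l\<in>{1..N}. if wt l = s then g l else (0::complex)) = (if s \<le> n then g (base s) else 0)"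
proof (cases "s \<le> n")
  case True
  then have "(\<Sum>l\<in>{1..N}. if wt l = s then g l else 0) = (\<Sum>l\<in>{1..N}. if l = base s then g l else 0)"
    using base wt_inj[of _ "base s"] by (intro sum.cong) (auto simp del: atLeastAtMost_iff)
  then show ?thesis using True base(1)[of s] by simp
next
  case False
  then show ?thesis using wt_le by (auto intro!: sum.neutral)
qed

lemma br_anti: "br i j k = - br j i k"
  by (rule gr_anti[OF skew_anti])

lemma gr_comp:
  "(\<Sum>l\<in>{1..N}. gr N wt a i j l * gr N wt b l k m) =
     (if i \<in> {1..N} \<and> j \<in> {1..N} \<and> k \<in> {1..N} \<and> m \<in> {1..N} \<and> wt m = wt i + wt j + wt k
      then a (wt i) (wt j) * b (wt i + wt j) (wt k) else 0)"
proof -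
  have "(\<Sum>l\<in>{1..N}. gr N wt a i j l * gr N wt b l k m) =
    (\<Sum>l\<in>{1..N}. if wt l = wt i + wt j then
      (if i \<in> {1..N} \<and> j \<in> {1..N} \<and> k \<in> {1..N} \<and> m \<in> {1..N} \<and> wt m = wt i + wt j + wt k
      then a (wt i) (wt j) * b (wt i + wt j) (wt k) else 0) else 0)"
    by (intro sum.cong) (auto simp: gr_def)
  also have "\<dots> = (if i \<in> {1..N} \<and> j \<in> {1..N} \<and> k \<in> {1..N} \<and> m \<in> {1..N} \<and> wt m = wt i + wt j + wt k
      then a (wt i) (wt j) * b (wt i + wt j) (wt k) else 0)"
    \<comment> \<open>If \<open>wt i + wt j\<close> exceeds \<open>n\<close> there is no
      intermediate vector, but then no \<open>m\<close> has the required weight either.\<close>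
    unfolding sum_weight using wt_le[of m] by auto
  finally show ?thesis .
qed

text \<open>The minus sign arises because \<open>d2\<close> puts the outer argument on the left of
  the bracket and \<open>cyc\<close> puts it on the right.\<close>

lemma d2_gr:
  assumes a: "\<And>p q. a p q = - a q p"
  shows "d2 N br (gr N wt a) i j k m =
    (if i \<in> {1..N} \<and> j \<in> {1..N} \<and> k \<in> {1..N} \<and> m \<in> {1..N} \<and> wt m = wt i + wt j + wt k
     then - cyc A a (wt i) (wt j) (wt k) else 0)"
proof -
  have swap: "(\<Sum>l\<in>{1..N}. gr N wt a j k l * br i l m) = - (\<Sum>l\<in>{1..N}. gr N wt a j k l * br l i m)" for i j k
    unfolding br_anti[of i] by (simp only: mult_minus_right sum_negf)
  have "A (wt i) (wt k) = - A (wt k) (wt i)" "a (wt i) (wt k) = - a (wt k) (wt i)"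
    by (rule skew_anti, rule a)
  then show ?thesis
    unfolding d2_eq swap gr_comp by (auto simp: cyc_def add_ac)
qed

text \<open>The terms containing \<open>a q r\<close> carry the total factor
  \<open>(q + r) - q - r\<close> and drop out. What remains says that \<open>a 0\<close> is additive
  wherever the bracket is nonzero, so it gives a diagonal derivation.\<close>

lemma cyc_0:
  assumes "\<And>p q. a p q = - a q p"
  shows "cyc A a 0 q r = A q r * (a 0 q + a 0 r - a 0 (q + r))"
  using assms[of r 0] assms[of r q] assms[of "q + r" 0]
  by (simp add: cyc_def A0 algebra_simps skew_anti[of P r q])

lemma cyc_all:
  assumes a: "\<And>p q. a p q = - a q p"
    and 0: "\<And>q r. q + r \<le> n \<Longrightarrow> cyc A a 0 q r = 0"
    and pos: "\<And>p q r. 0 < p \<Longrightarrow> p < q \<Longrightarrow> q < r \<Longrightarrow> p + q + r \<le> n \<Longrightarrow> cyc A a p q r = 0"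
    and le: "p + q + r \<le> n"
  shows "cyc A a p q r = 0"
proof -
  consider "p = 0" | "q = 0" | "r = 0" | "0 < p" "0 < q" "0 < r" by auto
  then show ?thesis
  proof cases
    case 1 then show ?thesis using 0[of q r] le by simp
  next
    case 2
    then show ?thesis using 0[of r p] le unfolding cyc_rotate[of A a p q r] by simp
  next
    case 3
    then show ?thesis using 0[of p q] le
      unfolding cyc_rotate[of A a p q r] cyc_rotate[of A a q r p] by simp
  next
    case 4 then show ?thesis by (intro cyc_eq_0_if_sorted[OF skew_anti a pos _ _ _ le])
  qed
qed

text \<open>Triples containing degree 0 satisfy the identity because degrees add under the
  bracket.\<close>

lemma jac_all: "p + q + r \<le> n \<Longrightarrow> cyc A A p q r = 0"
  by (rule cyc_all[OF skew_anti _ jac]) (simp_all add: cyc_0[OF skew_anti] A0)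

lemma br_jacobi:
  "(\<Sum>l\<in>{1..N}. br i j l * br l k m) + (\<Sum>l\<in>{1..N}. br j k l * br l i m)
     + (\<Sum>l\<in>{1..N}. br k i l * br l j m) = 0"
proof (cases "m \<in> {1..N} \<and> wt m = wt i + wt j + wt k")
  case True
  then have "cyc A A (wt i) (wt j) (wt k) = 0"
    using jac_all wt_le by metis
  then have "A (wt i) (wt j) * A (wt i + wt j) (wt k) + A (wt j) (wt k) * A (wt j + wt k) (wt i)
     + A (wt k) (wt i) * A (wt k + wt i) (wt j) = 0"
    unfolding cyc_self mult_eq_0_iff by simp
  then show ?thesis
    unfolding gr_comp using True by (auto simp: add_ac)
next
  case False
  then show ?thesis unfolding gr_comp by (auto simp: add_ac)
qed

lemma B2_le_Z2: "B2 N br \<subseteq> Z2 N br"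
proof
  fix w assume "w \<in> B2 N br"
  then obtain \<phi> where \<phi>: "\<phi> \<in> C1 N" "w = d1 N br \<phi>" by (auto simp: B2_def)
  have "d1 N br \<phi> i j k = - d1 N br \<phi> j i k" for i j k
  proof -
    have "(\<Sum>p\<in>{1..N}. br i j p * \<phi> p k) = - (\<Sum>p\<in>{1..N}. br j i p * \<phi> p k)"
      unfolding br_anti[of i j] by (simp only: mult_minus_left sum_negf)
    moreover have "c = - c' \<Longrightarrow> a - b - c = - (b - a - c')" for a b c c' :: complex
      by simp
    ultimately show ?thesis unfolding d1_eq by blast
  qed
  then have anti: "\<forall>i j k. d1 N br \<phi> i j k = - d1 N br \<phi> j i k" by blast
  have \<phi>0: "\<phi> i k = 0" if "i \<notin> {1..N} \<or> k \<notin> {1..N}" for i k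
    using that \<phi>(1) unfolding C1_def by blast
  have "d1 N br \<phi> i j k = 0" if "i \<notin> {1..N} \<or> j \<notin> {1..N} \<or> k \<notin> {1..N}" for i j k
  proof -
    have "\<phi> j l * br i l k - \<phi> i l * br j l k - br i j l * \<phi> l k = 0" for l
      using that \<phi>0[of j l] \<phi>0[of i l] \<phi>0[of l k] gr_outside[of i N l k wt A]
        gr_outside[of j N l k wt A] gr_outside[of i N j l wt A]
      by (elim disjE) (simp_all del: atLeastAtMost_iff)
    then show ?thesis unfolding d1_def by simp
  qed
  then have "d1 N br \<phi> \<in> C2 N" unfolding C2_def using anti by blast
  then show "w \<in> Z2 N br"
    unfolding \<phi>(2) Z2_def using d2_d1[of br N \<phi>, OF br_anti br_jacobi] by simp
qed

lemma base_wt: "i \<in> {1..N} \<Longrightarrow> base (wt i) = i"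
  using base wt_le wt_inj by metis

lemma br_x: "i \<in> {1..N} \<Longrightarrow> br (base 0) i k = (if k = i then - of_nat (wt i) else 0)"
  using base[of 0] wt_inj[of k i] by (auto simp: gr_def A0 simp del: atLeastAtMost_iff)

text \<open>Cartan's formula: \<open>x\<close> acts on cochains by \<open>d \<iota>\<^sub>x + \<iota>\<^sub>x d\<close>.\<close>

lemma contraction:
  assumes w: "w \<in> Z2 N br" and ijm: "i \<in> {1..N}" "j \<in> {1..N}" "m \<in> {1..N}"
  shows "(of_nat (wt i) + of_nat (wt j) - of_nat (wt m)) * w i j m = d1 N br (w (base 0)) i j m"
proof -
  have anti: "w i j k = - w j i k" for i j k using w unfolding Z2_def C2_def by blast
  have "d2 N br w (base 0) i j m = 0" using w by (simp add: Z2_def)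
  moreover have "(\<Sum>l\<in>{1..N}. w i j l * br (base 0) l m) = - of_nat (wt m) * w i j m"
  proof -
    have "(\<Sum>l\<in>{1..N}. w i j l * br (base 0) l m) = (\<Sum>l\<in>{1..N}. if l = m then - of_nat (wt m) * w i j m else 0)"
      by (intro sum.cong) (auto simp: br_x)
    then show ?thesis using ijm by simp
  qed
  moreover have "(\<Sum>l\<in>{1..N}. br (base 0) y l * w l z m) = - of_nat (wt y) * w y z m"
    if "y \<in> {1..N}" for y z
  proof -
    have "(\<Sum>l\<in>{1..N}. br (base 0) y l * w l z m) = (\<Sum>l\<in>{1..N}. if l = y then - of_nat (wt y) * w y z m else 0)"
      using that by (intro sum.cong) (auto simp: br_x)
    then show ?thesis using that by simp
  qed
  moreover have "(\<Sum>l\<in>{1..N}. br i j l * w l (base 0) m) = - (\<Sum>l\<in>{1..N}. br i j l * w (base 0) l m)"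
    unfolding anti[of _ "base 0"] by (simp only: mult_minus_right sum_negf)
  ultimately show ?thesis
    using ijm anti[of j i m] unfolding d2_eq d1_eq by (simp add: algebra_simps del: atLeastAtMost_iff)
qed

text \<open>Entries between equal weights are divided by 0, hence vanish; this is what makes the
identity hold also where the denominator on the right is 0.\<close>

lemma d1_weight_division:
  fixes \<psi> :: "nat \<Rightarrow> nat \<Rightarrow> complex"
  defines "\<phi> \<equiv> (\<lambda>i k. \<psi> i k / (of_nat (wt i) - of_nat (wt k)))"
  shows "d1 N br \<phi> i j m = d1 N br \<psi> i j m / (of_nat (wt i) + of_nat (wt j) - of_nat (wt m))"
proof -
  define D :: complex where "D = of_nat (wt i) + of_nat (wt j) - of_nat (wt m)"
  have "\<phi> j l * br i l m = \<psi> j l * br i l m / D" for l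
    by (auto simp: gr_def \<phi>_def D_def)
  moreover have "\<phi> i l * br j l m = \<psi> i l * br j l m / D" for l
    by (auto simp: gr_def \<phi>_def D_def)
  moreover have "br i j l * \<phi> l m = br i j l * \<psi> l m / D" for l
    by (auto simp: gr_def \<phi>_def D_def)
  ultimately show ?thesis
    unfolding d1_eq D_def[symmetric] by (simp only: sum_divide_distrib diff_divide_distrib)
qed

text \<open>Outside weight zero x acts invertibly, so dividing the contraction of \<open>w\<close>
  with x by the eigenvalues gives a map \<open>\<phi>\<close> whose coboundary is the part of
  \<open>w\<close> of nonzero weight. The entries of weight zero are collected in
  \<open>a\<close>.\<close>

lemma cocycle_weight_zero:
  assumes w: "w \<in> Z2 N br"
  obtains \<phi> a where "\<phi> \<in> C1 N" "w = d1 N br \<phi> + gr N wt a"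
    "\<And>p q. a p q = - a q p" "\<And>p q r. p + q + r \<le> n \<Longrightarrow> cyc A a p q r = 0"
proof -
  have anti: "w i j k = - w j i k" for i j k using w unfolding Z2_def C2_def by blast
  have out: "w i j k = 0" if "i \<notin> {1..N} \<or> j \<notin> {1..N} \<or> k \<notin> {1..N}" for i j k
    using w that unfolding Z2_def C2_def by blast
  define \<phi> where "\<phi> i k = w (base 0) i k / (of_nat (wt i) - of_nat (wt k))" for i k
  define a where "a p q = w (base p) (base q) (base (p + q))" for p q
  have \<phi>: "\<phi> \<in> C1 N" unfolding C1_def \<phi>_def using out by auto
  have d1\<phi>: "d1 N br \<phi> i j m = d1 N br (w (base 0)) i j m / (of_nat (wt i) + of_nat (wt j) - of_nat (wt m))" for i j m
    unfolding \<phi>_def by (rule d1_weight_division)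
  have B: "d1 N br \<phi> \<in> Z2 N br" using B2_le_Z2 \<phi> unfolding B2_def by blast
  have w_eq: "w i j m = d1 N br \<phi> i j m + gr N wt a i j m" for i j m
  proof (cases "i \<in> {1..N} \<and> j \<in> {1..N} \<and> m \<in> {1..N}")
    case True
    show ?thesis
    proof (cases "wt m = wt i + wt j")
      case eq: True
      then have "d1 N br \<phi> i j m = 0" unfolding d1\<phi> by simp
      moreover have "gr N wt a i j m = w i j m"
        using True eq base_wt[of i] base_wt[of j] base_wt[of m] by (simp add: gr_def a_def)
      ultimately show ?thesis by simp
    next
      case False
      then have "(of_nat (wt i) + of_nat (wt j) - of_nat (wt m) :: complex) \<noteq> 0"
        by (metis eq_iff_diff_eq_0 of_nat_add of_nat_eq_iff)
      then show ?thesis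
        using contraction[OF w, of i j m] True False unfolding d1\<phi> by (simp add: gr_def field_simps)
    qed
  next
    case False
    then have "w i j m = 0" "d1 N br \<phi> i j m = 0" "gr N wt a i j m = 0"
      using out[of i j m] gr_outside[of i N j m] B unfolding Z2_def C2_def by blast+
    then show ?thesis by simp
  qed
  have a: "a p q = - a q p" for p q unfolding a_def by (simp add: add.commute anti[of "base p"])
  have "cyc A a p q r = 0" if le: "p + q + r \<le> n" for p q r
  proof -
    have "d2 N br w i j k m = d2 N br (d1 N br \<phi>) i j k m + d2 N br (gr N wt a) i j k m" for i j k m
      unfolding d2_def by (simp add: w_eq sum.distrib[symmetric] algebra_simps)
    then have "d2 N br (gr N wt a) (base p) (base q) (base r) (base (p + q + r)) = 0"
      using w B unfolding Z2_def by simp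
    then show ?thesis
      unfolding d2_gr[OF a] using base le by (simp del: atLeastAtMost_iff)
  qed
  moreover have "w = d1 N br \<phi> + gr N wt a" by (intro ext) (simp only: plus_fun_def w_eq)
  ultimately show thesis using that[of \<phi> a] \<phi> a by blast
qed

lemma d1_diagonal: "gr N wt (cob A c) \<in> B2 N br"
proof -
  define \<phi> where "\<phi> i k = (if i = k \<and> i \<in> {1..N} then c (wt i) else 0)" for i k
  have "d1 N br \<phi> i j m = gr N wt (cob A c) i j m" for i j m
  proof -
    have 1: "(\<Sum>p\<in>{1..N}. \<phi> i p * br j p m) = (if i \<in> {1..N} then c (wt i) * br j i m else 0)" for i j m
    proof -
      have "(\<Sum>p\<in>{1..N}. \<phi> i p * br j p m) = (\<Sum>p\<in>{1..N}. if p = i then c (wt i) * br j i m else 0)"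
        by (intro sum.cong) (auto simp: \<phi>_def)
      then show ?thesis by simp
    qed
    have "(\<Sum>p\<in>{1..N}. br i j p * \<phi> p m) = (\<Sum>p\<in>{1..N}. if p = m then br i j m * c (wt m) else 0)"
      by (intro sum.cong) (auto simp: \<phi>_def)
    then have 2: "(\<Sum>p\<in>{1..N}. br i j p * \<phi> p m) = (if m \<in> {1..N} then br i j m * c (wt m) else 0)"
      by simp
    show ?thesis
      unfolding d1_eq 1 2 br_anti[of j i] by (simp add: gr_def cob_def algebra_simps)
  qed
  then have "d1 N br \<phi> = gr N wt (cob A c)" by (simp add: fun_eq_iff)
  moreover have "\<phi> \<in> C1 N" by (auto simp: C1_def \<phi>_def)
  ultimately show ?thesis unfolding B2_def by (metis image_eqI)
qed

lemma B2_add: "v \<in> B2 N br \<Longrightarrow> w \<in> B2 N br \<Longrightarrow> v + w \<in> B2 N br"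
proof -
  assume "v \<in> B2 N br" "w \<in> B2 N br"
  then obtain \<phi> \<psi> where *: "\<phi> \<in> C1 N" "\<psi> \<in> C1 N" "v = d1 N br \<phi>" "w = d1 N br \<psi>"
    unfolding B2_def by blast
  have "d1 N br (\<phi> + \<psi>) = v + w"
    unfolding * by (simp add: fun_eq_iff d1_def sum.distrib[symmetric] algebra_simps)
  moreover have "\<phi> + \<psi> \<in> C1 N" using * by (simp add: C1_def)
  ultimately show ?thesis unfolding B2_def by (metis image_eqI)
qed

lemma subspace_B2: "V3.subspace (B2 N br)"
proof (rule V3.subspaceI)
  have "(\<lambda>i k. 0) \<in> C1 N" by (simp add: C1_def)
  moreover have "d1 N br (\<lambda>i k. 0) = 0" by (simp add: fun_eq_iff d1_def)
  ultimately show "0 \<in> B2 N br" unfolding B2_def by (metis image_eqI)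
next
  fix c w assume "w \<in> B2 N br"
  then obtain \<phi> where *: "\<phi> \<in> C1 N" "w = d1 N br \<phi>" unfolding B2_def by blast
  have "(\<lambda>i k. c * \<phi> i k) \<in> C1 N" using * by (simp add: C1_def)
  moreover have "d1 N br (\<lambda>i k. c * \<phi> i k) = (\<lambda>i j k. c * w i j k)"
    unfolding * by (simp add: fun_eq_iff d1_def sum_distrib_left algebra_simps)
  ultimately show "(\<lambda>i j k. c * w i j k) \<in> B2 N br" unfolding B2_def by (metis image_eqI)
qed (rule B2_add)

end

text \<open>\<open>Q\<close> is the table of the generating cocycle, \<open>G\<close> the set of pairs at which coboundaries can be used to
make a cocycle vanish.\<close>

locale graded_rigid = graded +
  fixes Q :: "nat \<Rightarrow> nat \<Rightarrow> complex" and G :: "(nat \<times> nat) set" and u v :: nat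
  assumes Q0: "Q 0 q = 0"
    and cocycle: "\<And>p q r. 0 < p \<Longrightarrow> p < q \<Longrightarrow> q < r \<Longrightarrow> p + q + r \<le> n \<Longrightarrow> cyc A (skew Q) p q r = 0"
    and nontrivial: "u + v \<le> n" "A u v = 0" "skew Q u v \<noteq> 0"
    and gauge: "\<And>a. \<exists>c. \<forall>(p, q) \<in> G. cob A c p q = a p q"
    and rigid: "\<And>a. (\<And>p q. a p q = - a q p) \<Longrightarrow>
        (\<And>p q r. 0 < p \<Longrightarrow> 0 < q \<Longrightarrow> 0 < r \<Longrightarrow> p + q + r \<le> n \<Longrightarrow> cyc A a p q r = 0) \<Longrightarrow>
        (\<And>p q. (p, q) \<in> G \<Longrightarrow> a p q = 0) \<Longrightarrow>
        \<exists>s. \<forall>p q. 0 < p \<longrightarrow> p < q \<longrightarrow> p + q \<le> n \<longrightarrow> a p q = s * Q p q"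
    and derivation: "\<And>b :: nat \<Rightarrow> complex. (\<And>p q. 0 < p \<Longrightarrow> 0 < q \<Longrightarrow> p + q \<le> n \<Longrightarrow> A p q \<noteq> 0 \<Longrightarrow> b p + b q = b (p + q)) \<Longrightarrow>
        \<exists>t. \<forall>p. 0 < p \<longrightarrow> p \<le> n \<longrightarrow> b p = t * of_nat p"
begin

abbreviation "w0 \<equiv> gr N wt (skew Q)"

lemma skew_Q0: "skew Q 0 q = 0" "skew Q q 0 = 0"
  by (auto simp: skew_def Q0)

lemma w0_Z2: "w0 \<in> Z2 N br"
proof -
  have "cyc A (skew Q) p q r = 0" if "p + q + r \<le> n" for p q r
    by (rule cyc_all[OF skew_anti _ cocycle that]) (simp_all add: cyc_0[OF skew_anti] skew_Q0)
  then have "d2 N br w0 i j k m = 0" for i j k m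
    unfolding d2_gr[OF skew_anti] using wt_le[of m] by auto
  moreover have "w0 \<in> C2 N"
    unfolding C2_def using gr_outside gr_anti[of "skew Q", OF skew_anti] by blast
  ultimately show ?thesis by (simp add: Z2_def)
qed

text \<open>In the entry of a coboundary at weights \<open>u\<close>, \<open>v\<close>,
  \<open>u + v\<close>, every structure constant involved is \<open>A u v\<close> or
  \<open>A v u\<close> up to entries that vanish by weight. Hence all coboundaries, not only those
  of weight zero, are 0 there.\<close>

lemma w0_notin_B2: "w0 \<notin> B2 N br"
proof
  assume "w0 \<in> B2 N br"
  then obtain \<phi> where \<phi>: "w0 = d1 N br \<phi>" unfolding B2_def by blast
  let ?i = "base u" and ?j = "base v" and ?m = "base (u + v)"
  have b: "?i \<in> {1..N}" "?j \<in> {1..N}" "?m \<in> {1..N}" "wt ?i = u" "wt ?j = v" "wt ?m = u + v"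
    using base nontrivial(1) by (auto simp del: atLeastAtMost_iff)
  have "A v u = 0" using nontrivial(2) skew_anti[of P v u] by simp
  then have "br ?i p ?m = 0" "br ?j p ?m = 0" "br ?i ?j p = 0" for p
    using nontrivial(2) b by (auto simp: gr_def)
  then have "d1 N br \<phi> ?i ?j ?m = 0" unfolding d1_def by simp
  then have "w0 ?i ?j ?m = 0" unfolding \<phi> .
  then show False using nontrivial(3) b by (simp add: gr_def)
qed

lemma Z2_decompose:
  assumes "w \<in> Z2 N br"
  shows "\<exists>b\<in>B2 N br. \<exists>s. w = b + (\<lambda>i j k. s * w0 i j k)"
proof -
  obtain \<phi> a where \<phi>: "\<phi> \<in> C1 N" and w: "w = d1 N br \<phi> + gr N wt a"
    and a: "\<And>p q. a p q = - a q p" and cyc_a: "\<And>p q r. p + q + r \<le> n \<Longrightarrow> cyc A a p q r = 0"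
    using cocycle_weight_zero[OF assms] by blast
  have "a 0 p + a 0 q = a 0 (p + q)" if "p + q \<le> n" "A p q \<noteq> 0" for p q
    using cyc_a[of 0 p q] that unfolding cyc_0[OF a] by simp
  then obtain t where t: "\<And>p. 0 < p \<Longrightarrow> p \<le> n \<Longrightarrow> a 0 p = t * of_nat p"
    using derivation[of "a 0"] by blast
  obtain c where c: "\<And>p q. (p, q) \<in> G \<Longrightarrow> cob A c p q = a p q"
    using gauge[of a] by blast
  define a' where "a' p q = a p q - cob A c p q" for p q
  have cob_anti: "cob A c p q = - cob A c q p" for p q
    using skew_anti[of P p q] by (simp add: cob_def algebra_simps)
  have "\<exists>s. \<forall>p q. 0 < p \<longrightarrow> p < q \<longrightarrow> p + q \<le> n \<longrightarrow> a' p q = s * Q p q"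
  proof (rule rigid)
    show "a' p q = - a' q p" for p q
      unfolding a'_def using a[of p q] cob_anti[of p q] by simp
    show "cyc A a' p q r = 0" if "p + q + r \<le> n" for p q r
    proof -
      have "cyc A (cob A c) p q r = 0" using cyc_cob[of A c p q r] jac_all[OF that] by simp
      then show ?thesis
        using cyc_linear[of A a 1 "cob A c" p q r] cyc_a[OF that] unfolding a'_def by simp
    qed
    show "a' p q = 0" if "(p, q) \<in> G" for p q unfolding a'_def using c[OF that] by simp
  qed
  then obtain s where s: "\<And>p q. 0 < p \<Longrightarrow> p < q \<Longrightarrow> p + q \<le> n \<Longrightarrow> a' p q = s * Q p q"
    by blast
  \<comment> \<open>The value \<open>- t\<close> in degree 0 rescales x: since
    \<open>A 0 q = - of_nat q\<close>, it gives \<open>cob A c' 0 q = t * of_nat q\<close>, which is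
    \<open>a 0 q\<close> for \<open>0 < q \<le> n\<close>. Positive degrees keep the values of
    \<open>c\<close>.\<close>
  define c' where "c' p = (if p = 0 then - t else c p)" for p
  have c'_anti: "cob A c' p q = - cob A c' q p" for p q
    using skew_anti[of P p q] by (simp add: cob_def algebra_simps)
  have less: "a p q = cob A c' p q + s * skew Q p q" if "p < q" "p + q \<le> n" for p q
  proof (cases "p = 0")
    case True
    then show ?thesis using that t[of q] by (simp add: cob_def c'_def A0 skew_Q0)
  next
    case False
    then show ?thesis using that s[of p q] by (simp add: a'_def cob_def c'_def skew_def algebra_simps)
  qed
  have "a p q = cob A c' p q + s * skew Q p q" if "p + q \<le> n" for p q
  proof (cases p q rule: linorder_cases)
    case equal
    then show ?thesis using a[of p p] by (simp add: cob_def skew_def)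
  next
    case greater
    then show ?thesis
      using less[of q p] that a[of p q] c'_anti[of p q] skew_anti[of Q p q] by (simp add: add.commute)
  qed (use that less in auto)
  then have "gr N wt a i j k = gr N wt (cob A c') i j k + s * w0 i j k" for i j k
    using wt_le[of k] by (auto simp: gr_def)
  then have "w = (d1 N br \<phi> + gr N wt (cob A c')) + (\<lambda>i j k. s * w0 i j k)"
    unfolding w by (simp add: fun_eq_iff)
  moreover have "d1 N br \<phi> + gr N wt (cob A c') \<in> B2 N br"
    using \<phi> by (intro B2_add d1_diagonal) (simp add: B2_def)
  ultimately show ?thesis by blast
qed

theorem dimH2_eq_1: "dimH2 N br = 1"
proof -
  obtain E where E: "finite E" "{w. \<forall>i j k. i \<notin> {1..N} \<or> j \<notin> {1..N} \<or> k \<notin> {1..N} \<longrightarrow> w i j k = 0} \<subseteq> V3.span E"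
    using finite_spanning_family[of N] .
  then have "B2 N br \<subseteq> V3.span E"
    using B2_le_Z2 unfolding Z2_def C2_def by blast
  then show ?thesis
    unfolding dimH2_def
    by (rule cdim3_insert[OF subspace_B2 E(1) _ B2_le_Z2 w0_Z2 w0_notin_B2 Z2_decompose])
qed

end

section \<open>From bracket tables to the graded setting\<close>

lemma lie_br_eq_gr:
  assumes "\<And>i j k. 1 \<le> i \<Longrightarrow> i < j \<Longrightarrow> j \<le> N \<Longrightarrow> 1 \<le> k \<Longrightarrow> k \<le> N \<Longrightarrow> pos i j k = gr N wt (skew P) i j k"
  shows "lie_br N pos = gr N wt (skew P)"
proof (intro ext)
  fix i j k
  show "lie_br N pos i j k = gr N wt (skew P) i j k"
  proof (cases "i \<in> {1..N} \<and> j \<in> {1..N} \<and> k \<in> {1..N}")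
    case True
    consider "i < j" | "j < i" | "i = j" by linarith
    then show ?thesis
    proof cases
      case 1 then show ?thesis using True assms[of i j k] by (simp add: lie_br_def)
    next
      case 2 then show ?thesis
        using True assms[of j i k] gr_anti[of "skew P" N wt i j k, OF skew_anti]
        by (simp add: lie_br_def)
    next
      case 3 then show ?thesis by (simp add: lie_br_def gr_def skew_def)
    qed
  next
    case False
    then show ?thesis by (auto simp: lie_br_def gr_def)
  qed
qed

text \<open>The grading for algebras in which e_i has degree \<open>i\<close>; x is stored as the
  last basis vector and receives degree 0.\<close>

lemma lie_br_natural:
  assumes tri: "\<And>i j k. 1 \<le> i \<Longrightarrow> i < j \<Longrightarrow> j \<le> n \<Longrightarrow> k \<noteq> i + j \<or> n < k \<Longrightarrow> pos i j k = 0"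
    and x: "\<And>i k. 1 \<le> i \<Longrightarrow> i \<le> n \<Longrightarrow> pos i (Suc n) k = (if k = i then of_nat i else 0)"
  shows "lie_br (Suc n) pos = gr (Suc n) (\<lambda>i. if i = Suc n then 0 else i)
           (skew (\<lambda>p q. if p = 0 then - of_nat q else pos p q (p + q)))"
proof (rule lie_br_eq_gr)
  let ?P = "\<lambda>p q. if p = 0 then - of_nat q else pos p q (p + q)"
  let ?wt = "\<lambda>i. if i = Suc n then 0 else i"
  fix i j k
  assume ijk: "1 \<le> i" "i < j" "j \<le> Suc n" "1 \<le> k" "k \<le> Suc n"
  show "pos i j k = gr (Suc n) ?wt (skew ?P) i j k"
  proof (cases "j = Suc n")
    case True
    then show ?thesis using ijk x[of i k] by (auto simp: gr_def skew_def)
  next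
    case False
    then show ?thesis using ijk tri[of i j k] by (auto simp: gr_def skew_def)
  qed
qed

text \<open>With \<open>c 1 = 0\<close>, the pairs \<open>(1, i)\<close> give the recursion for
  \<open>h\<close>. The pair \<open>(2, 3)\<close> fixes \<open>h 2\<close>, because
  \<open>h 3 - h 5 = a 1 3 + a 1 4\<close>. The chain stops at degree \<open>n - 1\<close>, so
  \<open>c n\<close> is still free to solve the equation at \<open>(2, n - 2)\<close>.\<close>

lemma natural_gauge:
  fixes A a :: "nat \<Rightarrow> nat \<Rightarrow> complex"
  assumes n: "7 \<le> n" and A: "\<And>i. 2 \<le> i \<Longrightarrow> i \<le> n - 2 \<Longrightarrow> A 1 i = 1" "A 2 3 = 1" "A 2 (n - 2) = 1"
  shows "\<exists>c. \<forall>(p, q) \<in> {(1, i) |i. 2 \<le> i \<and> i \<le> n - 2} \<union> {(2, 3), (2, n - 2)}. cob A c p q = a p q"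
proof -
  define h where "h p = a 2 3 - a 1 3 - a 1 4 - (\<Sum>j\<in>{2..<p}. a 1 j)" for p
  define c where "c p = (if p = 1 then 0 else if p = n then h 2 + h (n - 2) - a 2 (n - 2) else h p)" for p
  have h: "h (Suc i) = h i - a 1 i" if "2 \<le> i" for i
    using that by (simp add: h_def)
  have h2: "h 2 = a 2 3 - a 1 3 - a 1 4" by (simp add: h_def)
  have "cob A c 1 i = a 1 i" if "2 \<le> i" "i \<le> n - 2" for i
    using that n h[of i] A(1)[of i] by (auto simp: cob_def c_def)
  moreover have "h 5 = h 3 - a 1 3 - a 1 4" using h[of 3] h[of 4] by (simp add: eval_nat_numeral)
  then have "cob A c 2 3 = a 2 3" using n A(2) h2 by (simp add: cob_def c_def)
  moreover have "cob A c 2 (n - 2) = a 2 (n - 2)"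
    using n A(3) by (auto simp: cob_def c_def)
  ultimately show ?thesis by (intro exI[of _ c]) auto
qed

text \<open>Bracketing with e_1 makes \<open>b\<close> an arithmetic progression with difference
  \<open>b 1\<close> from degree 2 to \<open>n - 1\<close>. The pair \<open>(2, 3)\<close> forces
  \<open>b 2 = 2 * b 1\<close>, and \<open>(2, n - 2)\<close> reaches degree
  \<open>n\<close>.\<close>

lemma natural_derivation:
  fixes A :: "nat \<Rightarrow> nat \<Rightarrow> complex" and b :: "nat \<Rightarrow> complex"
  assumes n: "7 \<le> n" and A: "\<And>i. 2 \<le> i \<Longrightarrow> i \<le> n - 2 \<Longrightarrow> A 1 i = 1" "A 2 3 = 1" "A 2 (n - 2) = 1"
    and b: "\<And>p q. 0 < p \<Longrightarrow> 0 < q \<Longrightarrow> p + q \<le> n \<Longrightarrow> A p q \<noteq> 0 \<Longrightarrow> b p + b q = b (p + q)"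
  shows "\<exists>t. \<forall>p. 0 < p \<longrightarrow> p \<le> n \<longrightarrow> b p = t * of_nat p"
proof -
  have step: "b (2 + k) = b 2 + of_nat k * b 1" if "2 + k \<le> n - 1" for k
    using that
  proof (induction k)
    case (Suc k)
    then show ?case using b[of 1 "2 + k"] A(1)[of "2 + k"] n by (simp add: algebra_simps)
  qed simp
  have "b 3 = b 2 + b 1" "b 5 = b 2 + 3 * b 1"
    using step[of 1] step[of 3] n by (simp_all add: eval_nat_numeral)
  moreover have "b 2 + b 3 = b 5" using b[of 2 3] A(2) n by simp
  ultimately have b2: "b 2 = 2 * b 1" by (simp add: algebra_simps)
  have small: "b p = b 1 * of_nat p" if p: "2 \<le> p" "p \<le> n - 1" for p
  proof -
    obtain k where "p = 2 + k" using le_Suc_ex[OF p(1)] by blast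
    then show ?thesis using step[of k] p b2 by (simp add: algebra_simps)
  qed
  have "2 + (n - 2) = n" using n by linarith
  then have "b n = b 2 + b (n - 2)" using b[of 2 "n - 2"] A(3) n by (simp only:) simp
  then have bn: "b n = b 1 * of_nat n" using small[of "n - 2"] b2 n by (simp add: of_nat_diff algebra_simps)
  have "b p = b 1 * of_nat p" if "0 < p" "p \<le> n" for p
  proof -
    have "p = 1 \<or> 2 \<le> p \<and> p \<le> n - 1 \<or> p = n" using that by arith
    then show ?thesis using small[of p] bn by auto
  qed
  then show ?thesis by blast
qed

text \<open>Reduces an algebra with e_i in degree \<open>i\<close> to finitely many linear
  identities once \<open>n\<close> is fixed. Nontriviality is read off at \<open>(1, n - 1)\<close>,
  where the bracket is zero and the generating cocycle is not.\<close>

lemma dimH2_natural: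
  fixes pos :: "nat \<Rightarrow> nat \<Rightarrow> nat \<Rightarrow> complex" and Q :: "nat \<Rightarrow> nat \<Rightarrow> complex"
  defines "A \<equiv> skew (\<lambda>p q. if p = 0 then - of_nat q else pos p q (p + q))"
  assumes n: "7 \<le> n"
    and tri: "\<And>i j k. 1 \<le> i \<Longrightarrow> i < j \<Longrightarrow> j \<le> n \<Longrightarrow> k \<noteq> i + j \<or> n < k \<Longrightarrow> pos i j k = 0"
    and x: "\<And>i k. 1 \<le> i \<Longrightarrow> i \<le> n \<Longrightarrow> pos i (Suc n) k = (if k = i then of_nat i else 0)"
    and e1: "\<And>i. 2 \<le> i \<Longrightarrow> i \<le> n - 2 \<Longrightarrow> pos 1 i (1 + i) = 1" "pos 1 (n - 1) n = 0"
    and e2: "pos 2 3 5 = 1" "pos 2 (n - 2) n = 1"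
    and Q: "\<And>q. Q 0 q = 0" "Q 1 (n - 1) \<noteq> 0"
    and jac: "\<And>p q r. 0 < p \<Longrightarrow> p < q \<Longrightarrow> q < r \<Longrightarrow> p + q + r \<le> n \<Longrightarrow> cyc A A p q r = 0"
    and cocycle: "\<And>p q r. 0 < p \<Longrightarrow> p < q \<Longrightarrow> q < r \<Longrightarrow> p + q + r \<le> n \<Longrightarrow> cyc A (skew Q) p q r = 0"
    and rigid: "\<And>a. (\<And>p. a p p = 0) \<Longrightarrow> (\<And>p q. q < p \<Longrightarrow> a p q = - a q p) \<Longrightarrow>
        (\<And>p q r. 0 < p \<Longrightarrow> 0 < q \<Longrightarrow> 0 < r \<Longrightarrow> p + q + r \<le> n \<Longrightarrow> cyc A a p q r = 0) \<Longrightarrow>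
        (\<And>i. 2 \<le> i \<Longrightarrow> i \<le> n - 2 \<Longrightarrow> a 1 i = 0) \<Longrightarrow> a 2 3 = 0 \<Longrightarrow> a 2 (n - 2) = 0 \<Longrightarrow>
        \<exists>s. \<forall>p q. 0 < p \<longrightarrow> p < q \<longrightarrow> p + q \<le> n \<longrightarrow> a p q = s * Q p q"
  shows "dimH2 (Suc n) (lie_br (Suc n) pos) = 1"
proof -
  let ?wt = "\<lambda>i. if i = Suc n then 0 else i"
  let ?P = "\<lambda>p q. if p = 0 then - of_nat q else pos p q (p + q)"
  let ?G = "{(1, i) |i. 2 \<le> i \<and> i \<le> n - 2} \<union> {(2, 3), (2, n - 2)}"
  have A: "A 1 i = 1" if "2 \<le> i" "i \<le> n - 2" for i
    using that e1(1)[of i] by (simp add: A_def skew_def)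
  have A': "A 2 3 = 1" "A 2 (n - 2) = 1"
  proof -
    have "2 < n - 2" "2 + (n - 2) = n" using n by linarith+
    then show "A 2 3 = 1" "A 2 (n - 2) = 1"
      using e2 by (simp_all only: A_def skew_def if_True) simp_all
  qed
  interpret graded_rigid "Suc n" n ?wt ?P Q ?G 1 "n - 1"
  proof (unfold_locales, fold A_def)
    show "bij_betw ?wt {1..Suc n} {..n}"
      by (rule bij_betw_byWitness[where f' = "\<lambda>p. if p = 0 then Suc n else p"]) auto
    show "A 1 (n - 1) = 0" "skew Q 1 (n - 1) \<noteq> 0"
      using e1(2) Q(2) n by (simp_all add: A_def skew_def)
    show "\<exists>c. \<forall>(p, q)\<in>?G. cob A c p q = a p q" for a
      using n A A' by (rule natural_gauge)
    show "\<exists>t. \<forall>p. 0 < p \<longrightarrow> p \<le> n \<longrightarrow> b p = t * of_nat p"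
      if "\<And>p q. 0 < p \<Longrightarrow> 0 < q \<Longrightarrow> p + q \<le> n \<Longrightarrow> A p q \<noteq> 0 \<Longrightarrow> b p + b q = b (p + q)"
      for b :: "nat \<Rightarrow> complex"
      using n A A' that by (rule natural_derivation)
    show "\<exists>s. \<forall>p q. 0 < p \<longrightarrow> p < q \<longrightarrow> p + q \<le> n \<longrightarrow> a p q = s * Q p q"
      if a: "\<And>p q. a p q = - a q p"
        and cy: "\<And>p q r. 0 < p \<Longrightarrow> 0 < q \<Longrightarrow> 0 < r \<Longrightarrow> p + q + r \<le> n \<Longrightarrow> cyc A a p q r = 0"
        and G: "\<And>p q. (p, q) \<in> ?G \<Longrightarrow> a p q = 0" for a
    proof (rule rigid)
      show "a p p = 0" for p using a[of p p] by simp
      show "a p q = - a q p" for p q by (rule a)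
      show "cyc A a p q r = 0" if "0 < p" "0 < q" "0 < r" "p + q + r \<le> n" for p q r
        using that by (rule cy)
    qed (rule G; blast)+
    show "cyc A A p q r = 0" "cyc A (skew Q) p q r = 0"
      if "0 < p" "p < q" "q < r" "p + q + r \<le> n" for p q r
      using that by (rule jac, rule cocycle)
  qed (use n Q(1) in simp_all)
  have "lie_br (Suc n) pos = br"
    by (rule lie_br_natural) (rule tri x; assumption)+
  then show ?thesis using dimH2_eq_1 by simp
qed

section \<open>The three algebras of fixed dimension\<close>

text \<open>The tables \<open>Q\<close> below solve the linear system of the cocycle conditions, normalised to vanish
at the pairs of \<open>natural_gauge\<close>.\<close>

lemma add_eq_0I: "x = 0 \<Longrightarrow> y = 0 \<Longrightarrow> x + y = (0 :: complex)"
  by simp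

definition Q_g17 :: "nat \<Rightarrow> nat \<Rightarrow> complex" where
  "Q_g17 p q = (if p = 1 \<and> q = 6 then 1 else if p = 3 \<and> q = 4 then 1 else 0)"

lemma dimH2_g17: "dimH2 8 (lie_br 8 pos_R_g17) = 1"
proof -
  let ?A = "skew (\<lambda>p q. if p = 0 then - of_nat q else pos_R_g17 p q (p + q))"
  have triples: "(p, q, r) \<in> {(1, 2, 3), (1, 2, 4)}"
    if "0 < p" "p < q" "q < r" "p + q + r \<le> 7" for p q r :: nat
    using that by simp presburger
  have pairs: "(p, q) \<in> {(1, 2), (1, 3), (1, 4), (1, 5), (1, 6), (2, 3), (2, 4), (2, 5),
      (3, 4)}"
    if "0 < p" "p < q" "p + q \<le> 7" for p q :: nat
    using that by simp presburger
  have "dimH2 (Suc 7) (lie_br (Suc 7) pos_R_g17) = 1"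
  proof (rule dimH2_natural[where Q = Q_g17])
    show "pos_R_g17 i j k = 0" if "1 \<le> i" "i < j" "j \<le> 7" "k \<noteq> i + j \<or> 7 < k" for i j k
      unfolding pos_R_g17_def using that by (intro add_eq_0I if_not_P; presburger)
    show "pos_R_g17 i (Suc 7) k = (if k = i then of_nat i else 0)" if "1 \<le> i" "i \<le> 7" for i k
      using that by (auto simp: pos_R_g17_def)
    show "pos_R_g17 1 i (1 + i) = 1" if "2 \<le> i" "i \<le> 7 - 2" for i
      using that by (auto simp: pos_R_g17_def)
    show "cyc ?A ?A p q r = 0" "cyc ?A (skew Q_g17) p q r = 0"
      if "0 < p" "p < q" "q < r" "p + q + r \<le> 7" for p q r
      using triples[OF that]
      by (elim insertE emptyE Pair_inject; hypsubst; simp add: cyc_def skew_def pos_R_g17_def Q_g17_def del: One_nat_def)+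
    fix a :: "nat \<Rightarrow> nat \<Rightarrow> complex"
    assume a: "\<And>p. a p p = 0" "\<And>p q. q < p \<Longrightarrow> a p q = - a q p"
      and cy: "\<And>p q r. 0 < p \<Longrightarrow> 0 < q \<Longrightarrow> 0 < r \<Longrightarrow> p + q + r \<le> 7 \<Longrightarrow> cyc ?A a p q r = 0"
      and a1: "\<And>i. 2 \<le> i \<Longrightarrow> i \<le> 7 - 2 \<Longrightarrow> a 1 i = 0" and a2: "a 2 3 = 0" "a 2 (7 - 2) = 0"
    have a2': "a 2 5 = 0" using a2(2) by simp
    \<comment> \<open>Antisymmetry, the normalisations and the table turn each cocycle condition
      into a linear equation between entries with increasing indices.\<close>
    note eval = cyc_def skew_def pos_R_g17_def a a1 a2(1) a2'
    have "cyc ?A a 1 2 3 = a 2 4"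
      by (simp add: eval del: One_nat_def)
    then have e123: "a 2 4 = 0" using cy[of 1 2 3] by simp
    have "cyc ?A a 1 2 4 = a 3 4 - a 1 6"
      by (simp add: eval del: One_nat_def)
    then have e124: "a 3 4 - a 1 6 = 0" using cy[of 1 2 4] by simp
    have a34: "a 3 4 = a 1 6" using  e123 e124 by algebra
    have "a p q = a 1 6 * Q_g17 p q" if "0 < p" "p < q" "p + q \<le> 7" for p q
      using pairs[OF that]
        by (elim insertE emptyE Pair_inject; hypsubst; simp add: Q_g17_def a1 a2(1) a2' e123 a34 del: One_nat_def)
    then show "\<exists>s. \<forall>p q. 0 < p \<longrightarrow> p < q \<longrightarrow> p + q \<le> 7 \<longrightarrow> a p q = s * Q_g17 p q"
      by blast
  qed (simp_all add: pos_R_g17_def Q_g17_def)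
  then show ?thesis by simp
qed

definition Q_g29 :: "nat \<Rightarrow> nat \<Rightarrow> complex" where
  "Q_g29 p q = (if p = 1 \<and> q = 8 then 1 else if p = 2 \<and> q = 5 then -12
      else if p = 2 \<and> q = 6 then -24 else if p = 3 \<and> q = 4 then 12
      else if p = 3 \<and> q = 5 then 12 else if p = 3 \<and> q = 6 then 5
      else if p = 4 \<and> q = 5 then -7 else 0)"

lemma dimH2_g29: "dimH2 10 (lie_br 10 pos_R_g29) = 1"
proof -
  let ?A = "skew (\<lambda>p q. if p = 0 then - of_nat q else pos_R_g29 p q (p + q))"
  have triples: "(p, q, r) \<in> {(1, 2, 3), (1, 2, 4), (1, 2, 5), (1, 2, 6), (1, 3, 4),
      (1, 3, 5), (2, 3, 4)}"
    if "0 < p" "p < q" "q < r" "p + q + r \<le> 9" for p q r :: nat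
    using that by simp presburger
  have pairs: "(p, q) \<in> {(1, 2), (1, 3), (1, 4), (1, 5), (1, 6), (1, 7), (1, 8), (2, 3),
      (2, 4), (2, 5), (2, 6), (2, 7), (3, 4), (3, 5), (3, 6), (4, 5)}"
    if "0 < p" "p < q" "p + q \<le> 9" for p q :: nat
    using that by simp presburger
  have "dimH2 (Suc 9) (lie_br (Suc 9) pos_R_g29) = 1"
  proof (rule dimH2_natural[where Q = Q_g29])
    show "pos_R_g29 i j k = 0" if "1 \<le> i" "i < j" "j \<le> 9" "k \<noteq> i + j \<or> 9 < k" for i j k
      unfolding pos_R_g29_def using that by (intro add_eq_0I if_not_P; presburger)
    show "pos_R_g29 i (Suc 9) k = (if k = i then of_nat i else 0)" if "1 \<le> i" "i \<le> 9" for i k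
      using that by (auto simp: pos_R_g29_def)
    show "pos_R_g29 1 i (1 + i) = 1" if "2 \<le> i" "i \<le> 9 - 2" for i
      using that by (auto simp: pos_R_g29_def)
    show "cyc ?A ?A p q r = 0" "cyc ?A (skew Q_g29) p q r = 0"
      if "0 < p" "p < q" "q < r" "p + q + r \<le> 9" for p q r
      using triples[OF that]
      by (elim insertE emptyE Pair_inject; hypsubst; simp add: cyc_def skew_def pos_R_g29_def Q_g29_def del: One_nat_def)+
    fix a :: "nat \<Rightarrow> nat \<Rightarrow> complex"
    assume a: "\<And>p. a p p = 0" "\<And>p q. q < p \<Longrightarrow> a p q = - a q p"
      and cy: "\<And>p q r. 0 < p \<Longrightarrow> 0 < q \<Longrightarrow> 0 < r \<Longrightarrow> p + q + r \<le> 9 \<Longrightarrow> cyc ?A a p q r = 0"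
      and a1: "\<And>i. 2 \<le> i \<Longrightarrow> i \<le> 9 - 2 \<Longrightarrow> a 1 i = 0" and a2: "a 2 3 = 0" "a 2 (9 - 2) = 0"
    have a2': "a 2 7 = 0" using a2(2) by simp
    note eval = cyc_def skew_def pos_R_g29_def a a1 a2(1) a2'
    have "cyc ?A a 1 2 3 = a 2 4"
      by (simp add: eval del: One_nat_def)
    then have e123: "a 2 4 = 0" using cy[of 1 2 3] by simp
    have "cyc ?A a 1 2 4 = a 3 4 - a 2 4 + a 2 5"
      by (simp add: eval del: One_nat_def)
    then have e124: "a 3 4 - a 2 4 + a 2 5 = 0" using cy[of 1 2 4] by simp
    have "cyc ?A a 1 2 5 = a 3 5 - a 2 5 + a 2 6"
      by (simp add: eval del: One_nat_def)
    then have e125: "a 3 5 - a 2 5 + a 2 6 = 0" using cy[of 1 2 5] by simp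
    have "cyc ?A a 1 2 6 = a 3 6 - 5 * a 1 8"
      by (simp add: eval del: One_nat_def)
    then have e126: "a 3 6 - 5 * a 1 8 = 0" using cy[of 1 2 6] by simp
    have "cyc ?A a 1 3 4 = - a 3 4 + a 3 5"
      by (simp add: eval del: One_nat_def)
    then have e134: "- a 3 4 + a 3 5 = 0" using cy[of 1 3 4] by simp
    have "cyc ?A a 1 3 5 = a 4 5 + 2 * a 1 8 + a 3 6"
      by (simp add: eval del: One_nat_def)
    then have e135: "a 4 5 + 2 * a 1 8 + a 3 6 = 0" using cy[of 1 3 5] by simp
    have "cyc ?A a 2 3 4 = - a 4 5 - a 3 4 - a 2 4 + a 3 6"
      by (simp add: eval del: One_nat_def)
    then have e234: "- a 4 5 - a 3 4 - a 2 4 + a 3 6 = 0" using cy[of 2 3 4] by simp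
    \<comment> \<open>Elimination order: \<open>e126\<close> and \<open>e135\<close> give
      \<open>a 3 6\<close> and \<open>a 4 5\<close>, then \<open>e234\<close> gives
      \<open>a 3 4\<close>, \<open>e134\<close> gives \<open>a 3 5\<close>, and \<open>e124\<close>,
      \<open>e125\<close> give \<open>a 2 5\<close> and \<open>a 2 6\<close>, all as multiples of
      \<open>a 1 8\<close>.\<close>
    note eqs = e123 e124 e125 e126 e134 e135 e234
    have a25: "a 2 5 = - 12 * a 1 8" using eqs by algebra
    have a26: "a 2 6 = - 24 * a 1 8" using eqs by algebra
    have a34: "a 3 4 = 12 * a 1 8" using eqs by algebra
    have a35: "a 3 5 = 12 * a 1 8" using eqs by algebra
    have a36: "a 3 6 = 5 * a 1 8" using eqs by algebra
    have a45: "a 4 5 = - 7 * a 1 8" using eqs by algebra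
    have "a p q = a 1 8 * Q_g29 p q" if "0 < p" "p < q" "p + q \<le> 9" for p q
      using pairs[OF that]
        by (elim insertE emptyE Pair_inject; hypsubst; simp add: Q_g29_def a1 a2(1) a2' e123 a25 a26 a34 a35 a36 a45 del: One_nat_def)
    then show "\<exists>s. \<forall>p q. 0 < p \<longrightarrow> p < q \<longrightarrow> p + q \<le> 9 \<longrightarrow> a p q = s * Q_g29 p q"
      by blast
  qed (simp_all add: pos_R_g29_def Q_g29_def)
  then show ?thesis by simp
qed

definition Q_g311 :: "nat \<Rightarrow> nat \<Rightarrow> complex" where
  "Q_g311 p q = (if p = 1 \<and> q = 10 then 4 else if p = 2 \<and> q = 5 then 3
      else if p = 2 \<and> q = 6 then 6 else if p = 2 \<and> q = 7 then 4
      else if p = 2 \<and> q = 8 then -3 else if p = 3 \<and> q = 4 then -3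
      else if p = 3 \<and> q = 5 then -3 else if p = 3 \<and> q = 6 then 2
      else if p = 3 \<and> q = 7 then 7 else if p = 4 \<and> q = 5 then -5
      else if p = 4 \<and> q = 6 then -5 else if p = 4 \<and> q = 7 then -4
      else if p = 5 \<and> q = 6 then 8 else 0)"

lemma dimH2_g311: "dimH2 12 (lie_br 12 pos_R_g311) = 1"
proof -
  let ?A = "skew (\<lambda>p q. if p = 0 then - of_nat q else pos_R_g311 p q (p + q))"
  have triples: "(p, q, r) \<in> {(1, 2, 3), (1, 2, 4), (1, 2, 5), (1, 2, 6), (1, 2, 7),
      (1, 2, 8), (1, 3, 4), (1, 3, 5), (1, 3, 6), (1, 3, 7), (1, 4, 5), (1, 4, 6), (2, 3, 4),
      (2, 3, 5), (2, 3, 6), (2, 4, 5)}"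
    if "0 < p" "p < q" "q < r" "p + q + r \<le> 11" for p q r :: nat
    using that by simp presburger
  have pairs: "(p, q) \<in> {(1, 2), (1, 3), (1, 4), (1, 5), (1, 6), (1, 7), (1, 8), (1, 9),
      (1, 10), (2, 3), (2, 4), (2, 5), (2, 6), (2, 7), (2, 8), (2, 9), (3, 4), (3, 5), (3, 6),
      (3, 7), (3, 8), (4, 5), (4, 6), (4, 7), (5, 6)}"
    if "0 < p" "p < q" "p + q \<le> 11" for p q :: nat
    using that by simp presburger
  have "dimH2 (Suc 11) (lie_br (Suc 11) pos_R_g311) = 1"
  proof (rule dimH2_natural[where Q = Q_g311])
    show "pos_R_g311 i j k = 0" if "1 \<le> i" "i < j" "j \<le> 11" "k \<noteq> i + j \<or> 11 < k" for i j k
      unfolding pos_R_g311_def using that by (intro add_eq_0I if_not_P; presburger)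
    show "pos_R_g311 i (Suc 11) k = (if k = i then of_nat i else 0)" if "1 \<le> i" "i \<le> 11" for i k
      using that by (auto simp: pos_R_g311_def)
    show "pos_R_g311 1 i (1 + i) = 1" if "2 \<le> i" "i \<le> 11 - 2" for i
      using that by (auto simp: pos_R_g311_def)
    show "cyc ?A ?A p q r = 0" "cyc ?A (skew Q_g311) p q r = 0"
      if "0 < p" "p < q" "q < r" "p + q + r \<le> 11" for p q r
      using triples[OF that]
      by (elim insertE emptyE Pair_inject; hypsubst; simp add: cyc_def skew_def pos_R_g311_def Q_g311_def del: One_nat_def)+
    fix a :: "nat \<Rightarrow> nat \<Rightarrow> complex"
    assume a: "\<And>p. a p p = 0" "\<And>p q. q < p \<Longrightarrow> a p q = - a q p"
      and cy: "\<And>p q r. 0 < p \<Longrightarrow> 0 < q \<Longrightarrow> 0 < r \<Longrightarrow> p + q + r \<le> 11 \<Longrightarrow> cyc ?A a p q r = 0"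
      and a1: "\<And>i. 2 \<le> i \<Longrightarrow> i \<le> 11 - 2 \<Longrightarrow> a 1 i = 0" and a2: "a 2 3 = 0" "a 2 (11 - 2) = 0"
    have a2': "a 2 9 = 0" using a2(2) by simp
    note eval = cyc_def skew_def pos_R_g311_def a a1 a2(1) a2'
    have "cyc ?A a 1 2 3 = a 2 4"
      by (simp add: eval del: One_nat_def)
    then have e123: "a 2 4 = 0" using cy[of 1 2 3] by simp
    have "cyc ?A a 1 2 4 = a 3 4 - a 2 4 + a 2 5"
      by (simp add: eval del: One_nat_def)
    then have e124: "a 3 4 - a 2 4 + a 2 5 = 0" using cy[of 1 2 4] by simp
    have "cyc ?A a 1 2 5 = a 3 5 - a 2 5 + a 2 6"
      by (simp add: eval del: One_nat_def)
    then have e125: "a 3 5 - a 2 5 + a 2 6 = 0" using cy[of 1 2 5] by simp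
    have "cyc ?A a 1 2 6 = a 3 6 - a 2 6 + a 2 7"
      by (simp add: eval del: One_nat_def)
    then have e126: "a 3 6 - a 2 6 + a 2 7 = 0" using cy[of 1 2 6] by simp
    have "cyc ?A a 1 2 7 = a 3 7 - a 2 7 + a 2 8"
      by (simp add: eval del: One_nat_def)
    then have e127: "a 3 7 - a 2 7 + a 2 8 = 0" using cy[of 1 2 7] by simp
    have "cyc ?A a 1 2 8 = a 3 8"
      by (simp add: eval del: One_nat_def)
    then have e128: "a 3 8 = 0" using cy[of 1 2 8] by simp
    have "cyc ?A a 1 3 4 = - a 3 4 + a 3 5"
      by (simp add: eval del: One_nat_def)
    then have e134: "- a 3 4 + a 3 5 = 0" using cy[of 1 3 4] by simp
    have "cyc ?A a 1 3 5 = a 4 5 - a 3 5 + a 3 6"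
      by (simp add: eval del: One_nat_def)
    then have e135: "a 4 5 - a 3 5 + a 3 6 = 0" using cy[of 1 3 5] by simp
    have "cyc ?A a 1 3 6 = a 4 6 - a 3 6 + a 3 7"
      by (simp add: eval del: One_nat_def)
    then have e136: "a 4 6 - a 3 6 + a 3 7 = 0" using cy[of 1 3 6] by simp
    have "cyc ?A a 1 3 7 = a 4 7 + a 1 10 + a 3 8"
      by (simp add: eval del: One_nat_def)
    then have e137: "a 4 7 + a 1 10 + a 3 8 = 0" using cy[of 1 3 7] by simp
    have "cyc ?A a 1 4 5 = - a 4 5 + a 4 6"
      by (simp add: eval del: One_nat_def)
    then have e145: "- a 4 5 + a 4 6 = 0" using cy[of 1 4 5] by simp
    have "cyc ?A a 1 4 6 = a 5 6 - a 1 10 + a 4 7"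
      by (simp add: eval del: One_nat_def)
    then have e146: "a 5 6 - a 1 10 + a 4 7 = 0" using cy[of 1 4 6] by simp
    have "cyc ?A a 2 3 4 = - a 4 5 + a 3 4 - a 2 7 + a 3 6"
      by (simp add: eval del: One_nat_def)
    then have e234: "- a 4 5 + a 3 4 - a 2 7 + a 3 6 = 0" using cy[of 2 3 4] by simp
    have "cyc ?A a 2 3 5 = - a 2 8 - a 2 5"
      by (simp add: eval del: One_nat_def)
    then have e235: "- a 2 8 - a 2 5 = 0" using cy[of 2 3 5] by simp
    have "cyc ?A a 2 3 6 = a 5 6 - a 3 6 - a 2 6 - a 3 8"
      by (simp add: eval del: One_nat_def)
    then have e236: "a 5 6 - a 3 6 - a 2 6 - a 3 8 = 0" using cy[of 2 3 6] by simp
    have "cyc ?A a 2 4 5 = a 2 4 - a 5 6 - a 4 5 + a 2 5"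
      by (simp add: eval del: One_nat_def)
    then have e245: "a 2 4 - a 5 6 - a 4 5 + a 2 5 = 0" using cy[of 2 4 5] by simp
    \<comment> \<open>Dividing by 4 keeps all table entries integral. The sixteen equations in
      fifteen unknown entries leave only this parameter.\<close>
    define s where "s = a 1 10 / 4"
    have s: "a 1 10 = 4 * s" by (simp add: s_def)
    note eqs = s e123 e124 e125 e126 e127 e128 e134 e135 e136 e137 e145 e146 e234 e235 e236 e245
    have a25: "a 2 5 = 3 * s" using eqs by algebra
    have a26: "a 2 6 = 6 * s" using eqs by algebra
    have a27: "a 2 7 = 4 * s" using eqs by algebra
    have a28: "a 2 8 = - 3 * s" using eqs by algebra
    have a34: "a 3 4 = - 3 * s" using eqs by algebra
    have a35: "a 3 5 = - 3 * s" using eqs by algebra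
    have a36: "a 3 6 = 2 * s" using eqs by algebra
    have a37: "a 3 7 = 7 * s" using eqs by algebra
    have a45: "a 4 5 = - 5 * s" using eqs by algebra
    have a46: "a 4 6 = - 5 * s" using eqs by algebra
    have a47: "a 4 7 = - 4 * s" using eqs by algebra
    have a56: "a 5 6 = 8 * s" using eqs by algebra
    have "a p q = s * Q_g311 p q" if "0 < p" "p < q" "p + q \<le> 11" for p q
      using pairs[OF that]
        by (elim insertE emptyE Pair_inject; hypsubst; simp add: Q_g311_def a1 a2(1) a2' s e123 a25 a26 a27 a28 a34 a35 a36 a37 e128 a45 a46 a47 a56 del: One_nat_def)
    then show "\<exists>s. \<forall>p q. 0 < p \<longrightarrow> p < q \<longrightarrow> p + q \<le> 11 \<longrightarrow> a p q = s * Q_g311 p q"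
      by blast
  qed (simp_all add: pos_R_g311_def Q_g311_def)
  then show ?thesis by simp
qed

section \<open>The family \<open>R(g\<^sup>3\<^sub>(\<^sub>n\<^sub>,\<^sub>1\<^sub>),1)\<close>\<close>

text \<open>Here \<open>e\<^sub>1\<close> has weight 1, \<open>e\<^sub>n\<close> weight 2 and the other \<open>e\<^sub>i\<close> weight \<open>i + 1\<close>. In terms of
weights the upper index bounds of the bracket table only say that the weight of the bracket is
at most \<open>n\<close>, which \<open>gr\<close> enforces anyway, so the table no longer depends on \<open>n\<close>.\<close>

definition P_g3 :: "nat \<Rightarrow> nat \<Rightarrow> complex" where
  "P_g3 p q = (if p = 0 then - of_nat q
     else if p = 1 \<and> 3 \<le> q then 1 else if p = 2 \<and> 3 \<le> q then -1 else if p = 3 \<and> 4 \<le> q then 1 else 0)"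

text \<open>The entry at \<open>(1, 2)\<close> deforms the zero bracket of e_1 and e_n into a
  multiple of e_2; the value 2 makes the other entries integral. The linear expressions solve the
  recursions along rows 2 and 3.\<close>

definition Q_g3 :: "nat \<Rightarrow> nat \<Rightarrow> complex" where
  "Q_g3 p q = (if p = 1 \<and> q = 2 then 2 else if p = 2 \<and> 4 \<le> q then 8 - 2 * of_nat q
     else if p = 3 \<and> 5 \<le> q then 3 * of_nat q - 15 else if p = 4 \<and> 5 \<le> q then -3 else 0)"

definition wt_g3 :: "nat \<Rightarrow> nat \<Rightarrow> nat" where
  "wt_g3 n i = (if i = Suc n then 0 else if i = 1 then 1 else if i = n then 2 else Suc i)"

lemma skew_P_g3:
  "3 \<le> q \<Longrightarrow> skew P_g3 1 q = 1" "3 \<le> q \<Longrightarrow> skew P_g3 q 1 = -1"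
  "3 \<le> q \<Longrightarrow> skew P_g3 2 q = -1" "3 \<le> q \<Longrightarrow> skew P_g3 q 2 = 1"
  "4 \<le> q \<Longrightarrow> skew P_g3 3 q = 1" "4 \<le> q \<Longrightarrow> skew P_g3 q 3 = -1"
  "4 \<le> p \<Longrightarrow> 4 \<le> q \<Longrightarrow> skew P_g3 p q = 0"
  "skew P_g3 1 2 = 0" "skew P_g3 2 1 = 0" "skew P_g3 p p = 0"
  by (auto simp: skew_def P_g3_def)

lemma skew_Q_g3:
  "3 \<le> q \<Longrightarrow> skew Q_g3 1 q = 0" "3 \<le> q \<Longrightarrow> skew Q_g3 q 1 = 0"
  "4 \<le> q \<Longrightarrow> skew Q_g3 2 q = 8 - 2 * of_nat q" "4 \<le> q \<Longrightarrow> skew Q_g3 q 2 = 2 * of_nat q - 8"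
  "5 \<le> q \<Longrightarrow> skew Q_g3 3 q = 3 * of_nat q - 15" "5 \<le> q \<Longrightarrow> skew Q_g3 q 3 = 15 - 3 * of_nat q"
  "5 \<le> q \<Longrightarrow> skew Q_g3 4 q = -3" "5 \<le> q \<Longrightarrow> skew Q_g3 q 4 = 3"
  "5 \<le> p \<Longrightarrow> 5 \<le> q \<Longrightarrow> skew Q_g3 p q = 0"
  "skew Q_g3 1 2 = 2" "skew Q_g3 2 1 = -2" "skew Q_g3 2 3 = 0" "skew Q_g3 3 2 = 0"
  "skew Q_g3 3 4 = 0" "skew Q_g3 4 3 = 0" "skew Q_g3 p p = 0"
  by (auto simp: skew_def Q_g3_def)

text \<open>The formulas of \<open>P_g3\<close> and \<open>Q_g3\<close> are uniform in an argument
  from 5 on, so only the values up to 4 need separate treatment.\<close>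

lemma sorted_triple_cases:
  assumes "0 < p" "p < q" "q < (r::nat)"
  obtains "p = 1" "q = 2" "r = 3" | "p = 1" "q = 2" "4 \<le> r" | "p = 1" "q = 3" "r = 4" | "p = 1" "q = 3" "5 \<le> r"
    | "p = 1" "q = 4" "5 \<le> r" | "p = 1" "5 \<le> q" "5 \<le> r" | "p = 2" "q = 3" "r = 4" | "p = 2" "q = 3" "5 \<le> r"
    | "p = 2" "q = 4" "5 \<le> r" | "p = 2" "5 \<le> q" "5 \<le> r"
    | "p = 3" "q = 4" "5 \<le> r" | "p = 3" "5 \<le> q" "5 \<le> r" | "p = 4" "5 \<le> q" "5 \<le> r" | "5 \<le> p" "5 \<le> q" "5 \<le> r"
proof -
  have "p = 1 \<or> p = 2 \<or> p = 3 \<or> p = 4 \<or> 5 \<le> p" "q = 2 \<or> q = 3 \<or> q = 4 \<or> 5 \<le> q" "r = 3 \<or> r = 4 \<or> 5 \<le> r"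
    using assms by linarith+
  then show thesis using assms that by (elim disjE) simp_all
qed

text \<open>There is no bound on the weights: the table defines an infinite-dimensional graded Lie
  algebra, and the members of the family are its truncations.\<close>

lemma jac_g3:
  assumes "0 < p" "p < q" "q < r"
  shows "cyc (skew P_g3) (skew P_g3) p q r = 0"
  using assms by (cases rule: sorted_triple_cases) (simp_all add: cyc_def skew_P_g3 del: One_nat_def)

lemma cocycle_g3:
  assumes "0 < p" "p < q" "q < r"
  shows "cyc (skew P_g3) (skew Q_g3) p q r = 0"
  using assms by (cases rule: sorted_triple_cases)
    (simp_all add: cyc_def skew_P_g3 skew_Q_g3 algebra_simps del: One_nat_def)

lemma gauge_g3:
  fixes a :: "nat \<Rightarrow> nat \<Rightarrow> complex"
  shows "\<exists>c. \<forall>(p, q) \<in> {(1, i) |i. 3 \<le> i} \<union> {(2, 3), (3, 4)}. cob (skew P_g3) c p q = a p q"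
proof -
  \<comment> \<open>The pairs \<open>(1, i)\<close> give the recursion for \<open>h\<close>. The
    start value comes from \<open>(3, 4)\<close>, since
    \<open>h 4 - h 7 = a 1 4 + a 1 5 + a 1 6\<close>, and \<open>c 2\<close> solves the equation at
    \<open>(2, 3)\<close>, where the bracket has coefficient -1.\<close>
  define h where "h p = a 3 4 - (a 1 4 + a 1 5 + a 1 6) - (\<Sum>j\<in>{3..<p}. a 1 j)" for p
  define c where "c p = (if p = 1 then 0 else if p = 2 then h 5 - h 3 - a 2 3 else h p)" for p
  have h: "h (Suc i) = h i - a 1 i" if "3 \<le> i" for i
    using that by (simp add: h_def)
  have "cob (skew P_g3) c 1 i = a 1 i" if "3 \<le> i" for i
    using that h[of i] skew_P_g3(1)[of i] by (auto simp: cob_def c_def)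
  moreover have "cob (skew P_g3) c 2 3 = a 2 3"
    using skew_P_g3(3)[of 3] by (simp add: cob_def c_def)
  moreover have "h 3 = a 3 4 - (a 1 4 + a 1 5 + a 1 6)" by (simp add: h_def)
  then have "cob (skew P_g3) c 3 4 = a 3 4"
    using skew_P_g3(5)[of 4] h[of 4] h[of 5] h[of 6] by (simp add: cob_def c_def)
  ultimately show ?thesis by (intro exI[of _ c]) auto
qed

text \<open>Degree 1 generates an arithmetic progression from degree 3 on. The pairs
  \<open>(2, 3)\<close> and \<open>(3, 4)\<close> then force \<open>b 2 = 2 * b 1\<close> and
  \<open>b 3 = 3 * b 1\<close>; the second one reaches degree 7.\<close>

lemma derivation_g3:
  fixes b :: "nat \<Rightarrow> complex"
  assumes n: "7 \<le> n"
    and b: "\<And>p q. 0 < p \<Longrightarrow> 0 < q \<Longrightarrow> p + q \<le> n \<Longrightarrow> skew P_g3 p q \<noteq> 0 \<Longrightarrow> b p + b q = b (p + q)"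
  shows "\<exists>t. \<forall>p. 0 < p \<longrightarrow> p \<le> n \<longrightarrow> b p = t * of_nat p"
proof -
  have step: "b (3 + k) = b 3 + of_nat k * b 1" if "3 + k \<le> n" for k
    using that
  proof (induction k)
    case (Suc k)
    then show ?case using b[of 1 "3 + k"] skew_P_g3(1)[of "3 + k"] by (simp add: algebra_simps)
  qed simp
  have s: "b 4 = b 3 + b 1" "b 5 = b 3 + 2 * b 1" "b 7 = b 3 + 4 * b 1"
    using step[of 1] step[of 2] step[of 4] n by simp_all
  have "b 2 + b 3 = b 5" using b[of 2 3] skew_P_g3(3)[of 3] n by simp
  then have b2: "b 2 = 2 * b 1" using s by (simp add: algebra_simps)
  have "b 3 + b 4 = b 7" using b[of 3 4] skew_P_g3(5)[of 4] n by simp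
  then have "b 3 + b 1 = 3 * b 1 + b 1" using s by simp
  then have b3: "b 3 = 3 * b 1" by (rule add_right_imp_eq)
  have "b p = b 1 * of_nat p" if p: "0 < p" "p \<le> n" for p
  proof -
    have "p = 1 \<or> p = 2 \<or> 3 \<le> p" using p by arith
    moreover have "b p = b 1 * of_nat p" if "3 \<le> p"
    proof -
      obtain k where "p = 3 + k" using le_Suc_ex[OF \<open>3 \<le> p\<close>] by blast
      then show ?thesis using step[of k] p b3 by (simp add: algebra_simps)
    qed
    ultimately show ?thesis using b2 by auto
  qed
  then show ?thesis by blast
qed

text \<open>Triples \<open>(1, 2, i)\<close> determine row 2 from \<open>a 1 2\<close>. Comparing
  triples \<open>(1, i, j)\<close> with \<open>(2, i, j)\<close> kills the entries with both indices
  at least 5, which leaves rows 3 and 4 depending on \<open>a 4 5\<close> alone; the triple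
  \<open>(2, 3, 4)\<close> ties this to \<open>a 1 2\<close>.\<close>

lemma rigid_g3:
  fixes a :: "nat \<Rightarrow> nat \<Rightarrow> complex"
  assumes n: "7 \<le> n"
    and a: "\<And>p q. a p q = - a q p"
    and cy: "\<And>p q r. 0 < p \<Longrightarrow> 0 < q \<Longrightarrow> 0 < r \<Longrightarrow> p + q + r \<le> n \<Longrightarrow> cyc (skew P_g3) a p q r = 0"
    and a1: "\<And>i. 3 \<le> i \<Longrightarrow> a 1 i = 0" and a23: "a 2 3 = 0" and a34: "a 3 4 = 0"
  shows "\<exists>s. \<forall>p q. 0 < p \<longrightarrow> p < q \<longrightarrow> p + q \<le> n \<longrightarrow> a p q = s * Q_g3 p q"
proof -
  define s where "s = a 1 2 / 2"
  have a12: "a 1 2 = 2 * s" by (simp add: s_def)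
  have a1': "a i 1 = 0" if "3 \<le> i" for i using a[of i 1] a1[OF that] by simp
  have diag: "a i i = 0" for i using a[of i i] by simp
  note [simp del] = One_nat_def
  have step2: "a 2 (1 + i) = a 2 i - 2 * s * skew P_g3 3 i" if "3 \<le> i" "3 + i \<le> n" for i
    using cy[of 1 2 i] that a1'[of i] a1'[of "Suc (Suc i)"] a[of "1 + i" 2]
    by (simp add: cyc_def skew_P_g3 a1 a12 algebra_simps)
  \<comment> \<open>The progression starts at 4: in degree 3 the bracket of f_3 with itself is zero,
    so \<open>a 2 4 = a 2 3 = 0\<close>.\<close>
  have a2: "a 2 (4 + k) = - 2 * s * of_nat k" if "6 + k \<le> n" for k
    using that
  proof (induction k)
    case 0
    then show ?case using step2[of 3] a23 by (simp add: skew_P_g3)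
  next
    case (Suc k)
    then have "a 2 (4 + k) = - 2 * s * of_nat k" by simp
    moreover have "a 2 (4 + Suc k) = a 2 (4 + k) - 2 * s"
      using step2[of "4 + k"] Suc.prems by (simp add: skew_P_g3)
    ultimately show ?case by (simp only: of_nat_Suc) (simp add: algebra_simps)
  qed
  have shift1: "a i j = a (i + 1) j + a i (j + 1)" if "3 \<le> i" "3 \<le> j" "1 + i + j \<le> n" for i j
  proof -
    have "cyc (skew P_g3) a 1 i j = a (i + 1) j + a i (j + 1) - a i j"
      using that a1[of i] a1'[of j] a1'[of "i + j"] a[of "j + 1" i]
      by (simp add: cyc_def skew_P_g3 add.commute)
    then show ?thesis using cy[of 1 i j] that by simp
  qed
  have shift2: "a i j = a (i + 2) j + a i (j + 2)" if "4 \<le> i" "4 \<le> j" "2 + i + j \<le> n" for i j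
  proof -
    have "cyc (skew P_g3) a 2 i j = a i j - (a (i + 2) j + a i (j + 2))"
      using that a[of "j + 2" i] by (simp add: cyc_def skew_P_g3 add.commute)
    then show ?thesis using cy[of 2 i j] that by simp
  qed
  \<comment> \<open>Using \<open>shift1\<close> twice gives
    \<open>a i j = a (i + 2) j + 2 * a (i + 1) (j + 1) + a i (j + 2)\<close>; subtracting
    \<open>shift2\<close> leaves the middle term.\<close>
  have zero: "a (i + 1) (j + 1) = 0" if "4 \<le> i" "4 \<le> j" "2 + i + j \<le> n" for i j
  proof -
    have "a i j = a (i + 1) j + a i (j + 1)" "a i j = a (i + 2) j + a i (j + 2)"
      using shift1[of i j] shift2[of i j] that by simp_all
    moreover have "a (i + 1) j = a (i + 2) j + a (i + 1) (j + 1)" "a i (j + 1) = a (i + 1) (j + 1) + a i (j + 2)"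
      using shift1[of "i + 1" j] shift1[of i "j + 1"] that by (simp_all add: add.assoc)
    ultimately show ?thesis by algebra
  qed
  \<comment> \<open>Row 5 vanishes by \<open>zero\<close>, so \<open>shift1\<close> makes row 4
    constant and thereby row 3 an arithmetic progression with difference
    \<open>- a 4 5\<close>.\<close>
  have a4: "a 4 (5 + k) = a 4 5" if "9 + k \<le> n" for k
    using that
  proof (induction k)
    case (Suc k)
    have "a 5 (5 + k) = 0" using zero[of 4 "4 + k"] Suc.prems by (simp add: add.commute)
    then show ?case using shift1[of 4 "5 + k"] Suc by (simp add: add.commute)
  qed simp
  have a35: "a 3 5 = 0" if "8 \<le> n"
    using shift1[of 3 4] that a34 diag by simp
  have a3: "a 3 (5 + k) = - of_nat k * a 4 5" if "8 + k \<le> n" for k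
    using that
  proof (induction k)
    case 0
    then show ?case using a35 by simp
  next
    case (Suc k)
    then have "a 3 (5 + k) = - of_nat k * a 4 5" by simp
    moreover have "a 3 (5 + k) = a 4 5 + a 3 (5 + Suc k)"
      using shift1[of 3 "5 + k"] a4[of k] Suc.prems by simp
    then have "a 3 (5 + Suc k) = a 3 (5 + k) - a 4 5" by simp
    ultimately show ?case by (simp only: of_nat_Suc) (simp add: algebra_simps)
  qed
  \<comment> \<open>The triple \<open>(2, 3, 4)\<close> has total weight 9; for smaller
    \<open>n\<close> the entry at \<open>(4, 5)\<close> lies outside the range.\<close>
  have a45: "a 4 5 = - 3 * s" if "9 \<le> n"
  proof -
    have "cyc (skew P_g3) a 2 3 4 = 0" using cy[of 2 3 4] that by simp
    then have "a 3 4 + a 6 3 = a 2 7 + (a 4 2 + a 5 4)"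
      using a[of 7 2] by (simp add: cyc_def skew_P_g3 algebra_simps)
    moreover have "a 2 7 = - 6 * s" "a 4 2 = 0" "a 6 3 = a 4 5" "a 5 4 = - a 4 5"
      using a2[of 3] a2[of 0] a3[of 1] a[of 4 2] a[of 6 3] a[of 5 4] that by simp_all
    ultimately have "a 4 5 = - 6 * s - a 4 5" using a34 by simp
    then have "2 * a 4 5 = - 6 * s" unfolding mult_2 by (simp only: eq_diff_eq)
    then have "2 * a 4 5 = 2 * (- 3 * s)" by simp
    then show ?thesis unfolding mult_cancel_left by simp
  qed
  have "a p q = s * Q_g3 p q" if pq: "0 < p" "p < q" "p + q \<le> n" for p q
  proof -
    have "p = 1 \<or> p = 2 \<or> p = 3 \<or> p = 4 \<or> 5 \<le> p" "q = 2 \<or> q = 3 \<or> q = 4 \<or> q = 5 \<or> 6 \<le> q"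
      using pq by linarith+
    then consider "p = 1 \<and> q = 2" | "p = 1 \<and> 3 \<le> q" | "p = 2 \<and> q = 3" | "p = 2 \<and> 4 \<le> q"
      | "p = 3 \<and> q = 4" | "p = 3 \<and> q = 5" | "p = 3 \<and> 6 \<le> q" | "p = 4 \<and> 5 \<le> q" | "5 \<le> p \<and> 5 \<le> q"
      using pq by (elim disjE) simp_all
    then show ?thesis
    proof cases
      case 1 then show ?thesis by (simp add: Q_g3_def a12)
    next
      case 2 then show ?thesis by (simp add: Q_g3_def a1)
    next
      case 3 then show ?thesis by (simp add: Q_g3_def a23)
    next
      case 4
      then obtain k where "q = 4 + k" using le_Suc_ex[of 4 q] by blast
      then show ?thesis using 4 a2[of k] pq by (simp add: Q_g3_def algebra_simps)
    next
      case 5 then show ?thesis by (simp add: Q_g3_def a34)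
    next
      case 6 then show ?thesis using a35 pq by (simp add: Q_g3_def)
    next
      case 7
      then obtain k where "q = 5 + Suc k" using le_Suc_ex[of 6 q] by auto
      then show ?thesis using 7 a3[of "Suc k"] a45 pq by (simp add: Q_g3_def algebra_simps)
    next
      case 8
      then obtain k where "q = 5 + k" using le_Suc_ex[of 5 q] by blast
      then show ?thesis using 8 a4[of k] a45 pq by (simp add: Q_g3_def)
    next
      case 9
      then have "4 \<le> p - 1" "4 \<le> q - 1" by linarith+
      then show ?thesis using 9 zero[of "p - 1" "q - 1"] pq by (simp add: Q_g3_def)
    qed
  qed
  then show ?thesis by blast
qed

text \<open>As e_n has weight 2 and stands second in [e_i, e_n], its row in \<open>P_g3\<close> has
  sign -1; e_2 has weight 3 and supplies row 3.\<close>

lemma lie_br_g3: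
  assumes n: "7 \<le> n"
  shows "lie_br (n + 1) (pos_R_g3n1 n) = gr (Suc n) (wt_g3 n) (skew P_g3)"
  unfolding Suc_eq_plus1[symmetric]
proof (rule lie_br_eq_gr)
  fix i j k
  assume ijk: "1 \<le> i" "i < j" "j \<le> Suc n" "1 \<le> k" "k \<le> Suc n"
  consider "j = Suc n" | "j = n" | "j < n" "i = 1" | "j < n" "i = 2" | "j < n" "3 \<le> i"
    using ijk(1,3) by linarith
  then show "pos_R_g3n1 n i j k = gr (Suc n) (wt_g3 n) (skew P_g3) i j k"
    using ijk n
    by cases (auto simp: pos_R_g3n1_def gr_def wt_g3_def skew_def P_g3_def)
qed

lemma dimH2_g3n1:
  assumes n: "7 \<le> n"
  shows "dimH2 (n + 1) (lie_br (n + 1) (pos_R_g3n1 n)) = 1"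
proof -
  let ?G = "{(1, i) |i. 3 \<le> i} \<union> {(2, 3), (3, 4)}"
  \<comment> \<open>Weights 1 and 2 belong to the commuting vectors e_1 and e_n, where the
    generating cocycle takes the value 2.\<close>
  interpret graded_rigid "Suc n" n "wt_g3 n" P_g3 Q_g3 ?G 1 2
  proof unfold_locales
    show "bij_betw (wt_g3 n) {1..Suc n} {..n}"
      by (rule bij_betw_byWitness[where
            f' = "\<lambda>p. if p = 0 then Suc n else if p = 1 then 1 else if p = 2 then n else p - 1"])
        (use n in \<open>auto simp: wt_g3_def\<close>)
    show "\<exists>c. \<forall>(p, q)\<in>?G. cob (skew P_g3) c p q = a p q" for a
      by (rule gauge_g3)
    show "\<exists>t. \<forall>p. 0 < p \<longrightarrow> p \<le> n \<longrightarrow> b p = t * of_nat p"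
      if "\<And>p q. 0 < p \<Longrightarrow> 0 < q \<Longrightarrow> p + q \<le> n \<Longrightarrow> skew P_g3 p q \<noteq> 0 \<Longrightarrow> b p + b q = b (p + q)"
      for b :: "nat \<Rightarrow> complex"
      using n that by (rule derivation_g3)
    show "\<exists>s. \<forall>p q. 0 < p \<longrightarrow> p < q \<longrightarrow> p + q \<le> n \<longrightarrow> a p q = s * Q_g3 p q"
      if a: "\<And>p q. a p q = - a q p"
        and cy: "\<And>p q r. 0 < p \<Longrightarrow> 0 < q \<Longrightarrow> 0 < r \<Longrightarrow> p + q + r \<le> n \<Longrightarrow> cyc (skew P_g3) a p q r = 0"
        and G: "\<And>p q. (p, q) \<in> ?G \<Longrightarrow> a p q = 0" for a
    proof (rule rigid_g3[OF n])
      show "a p q = - a q p" for p q by (rule a)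
      show "cyc (skew P_g3) a p q r = 0" if "0 < p" "0 < q" "0 < r" "p + q + r \<le> n" for p q r
        using that by (rule cy)
    qed (rule G; simp)+
    show "cyc (skew P_g3) (skew P_g3) p q r = 0" "cyc (skew P_g3) (skew Q_g3) p q r = 0"
      if "0 < p" "p < q" "q < r" "p + q + r \<le> n" for p q r
      using that(1-3) by (rule jac_g3, rule cocycle_g3)
  qed (use n in \<open>simp_all add: P_g3_def Q_g3_def skew_def\<close>)
  show ?thesis
    unfolding lie_br_g3[OF n] using dimH2_eq_1 by simp
qed

theorem theorem3p10:
  shows "(\<forall>n::nat. n \<ge> 7 \<longrightarrow> dimH2 (n + 1) (lie_br (n + 1) (pos_R_g3n1 n)) = 1)
       \<and> dimH2 8 (lie_br 8 pos_R_g17) = 1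
       \<and> dimH2 10 (lie_br 10 pos_R_g29) = 1
       \<and> dimH2 12 (lie_br 12 pos_R_g311) = 1"
  using dimH2_g3n1 dimH2_g17 dimH2_g29 dimH2_g311 by blast

end
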